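(* Let $G$ be a 2-connected graph such that the $\mathrm{Gem}$ is not an induced minor of $G$. Then there is a subset $X \subseteq V(G)$ with $|X| \le 6$ such that every connected component of $G \setminus X$ is either a cograph, or a path whose internal vertices all have degree two in $G$.
   Context: Graphs are finite and simple. $H$ is an induced minor of $G$ if $H$ can be obtained from $G$ by vertex deletions and edge contractions. The $\mathrm{Gem}$ is the graph obtained from the path $P_4$ on four vertices by adding a vertex adjacent to all four path vertices. A cograph is a graph that does not contain $P_4$ as an induced subgraph. *)

theory Defs
  imports "Graph_Theory.Graph_Theory"
begin

text \<open>Finite simple graphs are represented by the locale \<^locale>\<open>pair_graph\<close>: finite, loop-free,
  symmetric digraphs whose arcs are pairs, so that an edge \<open>{u, v}\<close> is the pair of arcs
  \<open>(u, v)\<close>, \<open>(v, u)\<close>. Correspondingly, \<^const>\<open>in_degree\<close> is the number of neighbours.\<close>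

definition path4 :: "nat pair_pre_digraph" where
  "path4 = \<lparr> pverts = {..<4},
             parcs = {(i, j). i < 4 \<and> j < 4 \<and> (j = Suc i \<or> i = Suc j)} \<rparr>"

definition gem :: "nat pair_pre_digraph" where
  "gem = \<lparr> pverts = insert 4 (pverts path4),
           parcs = parcs path4 \<union> {4} \<times> pverts path4 \<union> pverts path4 \<times> {4} \<rparr>"

text \<open>Contraction of the edge \<open>{u, v}\<close>: the merged vertex keeps the name \<open>u\<close>; loops are dropped
  and parallel edges are identified.\<close>

definition contract_edge :: "'a pair_pre_digraph \<Rightarrow> 'a \<Rightarrow> 'a \<Rightarrow> 'a pair_pre_digraph" where
  "contract_edge G u v =
     (let f = id(v := u)
      in \<lparr> pverts = f ` pverts G, parcs = {(f x, f y) | x y. (x, y) \<in> parcs G \<and> f x \<noteq> f y} \<rparr>)"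

inductive reduces_to :: "'a pair_pre_digraph \<Rightarrow> 'a pair_pre_digraph \<Rightarrow> bool" for G where
  refl: "reduces_to G G"
| delete: "reduces_to G H \<Longrightarrow> v \<in> pverts H
    \<Longrightarrow> with_proj H' = pre_digraph.del_vert (with_proj H) v \<Longrightarrow> reduces_to G H'"
| contract: "reduces_to G H \<Longrightarrow> (u, v) \<in> parcs H \<Longrightarrow> reduces_to G (contract_edge H u v)"

definition induced_minor :: "'b pair_pre_digraph \<Rightarrow> 'a pair_pre_digraph \<Rightarrow> bool" where
  "induced_minor H G \<longleftrightarrow> (\<exists>H'. reduces_to G H' \<and> digraph_iso (with_proj H) (with_proj H'))"

definition k_connected :: "nat \<Rightarrow> ('a, 'b) pre_digraph \<Rightarrow> bool" where
  "k_connected k G \<longleftrightarrow> k < card (verts G) \<and>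
     (\<forall>S \<subseteq> verts G. card S < k \<longrightarrow> connected (G \<restriction> (verts G - S)))"

definition cograph :: "('a, 'b) pre_digraph \<Rightarrow> bool" where
  "cograph G \<longleftrightarrow> graph G \<and> \<not> (\<exists>H. induced_subgraph H G \<and> digraph_iso (with_proj path4) H)"

text \<open>The graph \<open>C\<close> is, as a whole, the path traversed by the arc list \<open>p\<close> starting at \<open>u\<close>. The
  one-vertex path is \<open>p = []\<close>.\<close>

definition is_path_along :: "('a, 'b) pre_digraph \<Rightarrow> 'a \<Rightarrow> 'b awalk \<Rightarrow> 'a \<Rightarrow> bool" where
  "is_path_along C u p v \<longleftrightarrow> pre_digraph.apath C u p v \<and>
     verts C = set (pre_digraph.awalk_verts C u p) \<and>
     arcs_ends C = arc_to_ends C ` set p \<union> (arc_to_ends C ` set p)\<inverse>"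

end

theory Submission
  imports Defs
begin

text \<open>
  Call a two-vertex set \<open>{a, c}\<close> a thick cut if its removal leaves at least three components, or at
  least two while \<open>a\<close> and \<open>c\<close> are adjacent. In both cases the side of \<open>c\<close> stays joined to the side of
  \<open>a\<close> after removing any two components \<open>D\<close> and \<open>L\<close>, and \<open>L\<close> serves as an end of the gem path;
  this forces each component \<open>D\<close> to be either complete to \<open>{a, c}\<close>, hence a cograph, or a path
  attached only by its ends. So \<open>X = {a, c}\<close> works.

  Without thick cuts, suppose there is a hole of length at least five. A component of its
  complement must be attached to exactly three consecutive hole vertices, all components have the
  same centre \<open>b\<close>, and the two hole neighbours \<open>a, c\<close> of \<open>b\<close> separate a path of vertices of degree two from
  a part that is complete to \<open>{a, c}\<close>; again \<open>X = {a, c}\<close>.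

  If there are no such holes either, then every component of the complement of an induced
  \<open>p1 p2 p3 p4\<close> is attached to both ends and to exactly one middle vertex, different components have
  different middle vertices, and each component is a single vertex. Hence the graph is a cograph
  or has at most six vertices, the extreme case being the prism.
\<close>

text \<open>The gem is used only through branch sets (\<open>gemfree\<close>). Components of induced
  subgraphs then serve directly as gem vertices, contractions appear only in the final translation,
  and every contradiction is a choice of one hub and four path sets. 2-connectivity mostly enters by
  giving each piece that has been cut off a second attachment. The obstacle is a two-vertex cut with
  just two components and non-adjacent \<open>a\<close>, \<open>c\<close>, as in a long cycle:
  nothing then replaces the hub \<open>A \<union> M\<close> of \<open>link_gem\<close>, which has to
  reach \<open>C\<close> without help from \<open>D\<close> and \<open>L\<close>. Such a cut is
  still usable in the hole case, because \<open>complete_comp\<close> needs no set \<open>M\<close>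
  once every vertex of \<open>D\<close> is known to see both or none of \<open>a\<close>,
  \<open>c\<close>. More than two vertices are deleted only when \<open>card V \<le> 6\<close>, and
  then all of \<open>V\<close> is.\<close>

locale sgraph =
  fixes V :: "'a set" and E :: "('a \<times> 'a) set"
  assumes finite_V: "finite V"
    and E_sub: "E \<subseteq> V \<times> V"
    and sym_E: "sym E"
    and irrefl_E: "(x, x) \<notin> E"
begin

section \<open>Connected sets and components of induced subgraphs\<close>

definition adj :: "'a \<Rightarrow> 'a \<Rightarrow> bool" where
  "adj x y \<longleftrightarrow> (x, y) \<in> E"

definition nbr :: "'a \<Rightarrow> 'a set \<Rightarrow> bool" where
  "nbr x B \<longleftrightarrow> (\<exists>y \<in> B. adj x y)"

definition touch :: "'a set \<Rightarrow> 'a set \<Rightarrow> bool" where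
  "touch A B \<longleftrightarrow> (\<exists>x \<in> A. nbr x B)"

text \<open>Phrased by cuts rather than by walks, so that closed-set arguments replace inductions
  along paths.\<close>

definition conn :: "'a set \<Rightarrow> bool" where
  "conn S \<longleftrightarrow> S \<noteq> {} \<and> S \<subseteq> V \<and> (\<forall>A. A \<noteq> {} \<longrightarrow> A \<subset> S \<longrightarrow> touch A (S - A))"

definition is_comp :: "'a set \<Rightarrow> 'a set \<Rightarrow> bool" where
  "is_comp S C \<longleftrightarrow> C \<subseteq> S \<and> conn C \<and> \<not> touch C (S - C)"

lemma adj_commute: "adj x y \<longleftrightarrow> adj y x"
  using sym_E by (auto simp: adj_def sym_def)

lemma adj_irrefl [simp]: "\<not> adj x x"
  using irrefl_E by (simp add: adj_def)

lemma adj_in_V: "adj x y \<Longrightarrow> x \<in> V \<and> y \<in> V"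
  using E_sub by (auto simp: adj_def)

lemma nbr_empty [simp]: "\<not> nbr x {}"
  and nbr_insert [simp]: "nbr x (insert y B) \<longleftrightarrow> adj x y \<or> nbr x B"
  and nbr_Un [simp]: "nbr x (A \<union> B) \<longleftrightarrow> nbr x A \<or> nbr x B"
  by (auto simp: nbr_def)

lemma touch_commute: "touch A B \<longleftrightarrow> touch B A"
  using adj_commute by (auto simp: touch_def nbr_def)

lemma touch_empty [simp]: "\<not> touch {} B" "\<not> touch B {}"
  and touch_insert1 [simp]: "touch (insert x A) B \<longleftrightarrow> nbr x B \<or> touch A B"
  and touch_Un1 [simp]: "touch (A \<union> B) C \<longleftrightarrow> touch A C \<or> touch B C"
  by (auto simp: touch_def)

lemma touch_insert2 [simp]: "touch B (insert x A) \<longleftrightarrow> nbr x B \<or> touch B A"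
  and touch_Un2 [simp]: "touch C (A \<union> B) \<longleftrightarrow> touch C A \<or> touch C B"
  by (metis touch_commute touch_insert1, metis touch_commute touch_Un1)

lemma nbr_mono: "nbr x A \<Longrightarrow> A \<subseteq> B \<Longrightarrow> nbr x B"
  by (auto simp: nbr_def)

lemma touch_mono: "touch A B \<Longrightarrow> A \<subseteq> A' \<Longrightarrow> B \<subseteq> B' \<Longrightarrow> touch A' B'"
  by (force simp: touch_def nbr_def)

lemma touch_iff: "touch A B \<longleftrightarrow> (\<exists>x\<in>A. \<exists>y\<in>B. adj x y)"
  by (auto simp: touch_def nbr_def)

lemma connD: "conn S \<Longrightarrow> S \<noteq> {}" "conn S \<Longrightarrow> S \<subseteq> V"
  by (auto simp: conn_def)

lemma conn_touch: "conn S \<Longrightarrow> A \<noteq> {} \<Longrightarrow> A \<subseteq> S \<Longrightarrow> A \<noteq> S \<Longrightarrow> touch A (S - A)"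
  by (auto simp: conn_def)

lemma conn_singleton [simp]: "conn {x} \<longleftrightarrow> x \<in> V"
  by (auto simp: conn_def)

text \<open>Otherwise \<open>A \<inter> C\<close> would be a proper part of \<open>C\<close> without
  an edge to the remainder. The facts on unions of connected sets and on components rest on this
  closure argument.\<close>

lemma conn_closed_subset:
  assumes "conn C" "C \<subseteq> S" "A \<inter> C \<noteq> {}" "\<not> touch A (S - A)"
  shows "C \<subseteq> A"
proof (rule ccontr)
  assume "\<not> C \<subseteq> A"
  then have "touch (A \<inter> C) (C - A \<inter> C)"
    using conn_touch[OF assms(1), of "A \<inter> C"] assms(3) by blast
  then show False
    using assms(2,4) by (auto simp: touch_iff)
qed

lemma conn_Union:
  assumes "\<And>C. C \<in> F \<Longrightarrow> conn C \<and> x \<in> C" "F \<noteq> {}"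
  shows "conn (\<Union>F)"
  unfolding conn_def
proof (intro conjI allI impI)
  show "\<Union>F \<noteq> {}" "\<Union>F \<subseteq> V" using assms by (auto dest: connD)
next
  fix A assume A: "A \<noteq> {}" "A \<subset> \<Union>F"
  show "touch A (\<Union>F - A)"
  proof (rule ccontr)
    assume nt: "\<not> touch A (\<Union>F - A)"
    have 1: "C \<subseteq> A" if "C \<in> F" "A \<inter> C \<noteq> {}" for C
      using conn_closed_subset[of C "\<Union>F" A] that nt assms(1) by blast
    obtain C where "C \<in> F" "A \<inter> C \<noteq> {}" using A by blast
    then have "x \<in> A" using 1 assms(1) by blast
    then have "\<Union>F \<subseteq> A" using 1 assms(1) by blast
    then show False using A by blast
  qed
qed

lemma conn_Un:
  assumes "conn A" "conn B" "touch A B \<or> A \<inter> B \<noteq> {}"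
  shows "conn (A \<union> B)"
  unfolding conn_def
proof (intro conjI allI impI)
  show "A \<union> B \<noteq> {}" "A \<union> B \<subseteq> V" using assms by (auto dest: connD)
next
  fix C assume C: "C \<noteq> {}" "C \<subset> A \<union> B"
  show "touch C (A \<union> B - C)"
  proof (rule ccontr)
    assume nt: "\<not> touch C (A \<union> B - C)"
    have 1: "A \<subseteq> C" if "C \<inter> A \<noteq> {}"
      using conn_closed_subset[of A "A \<union> B" C] that nt assms(1) by blast
    have 2: "B \<subseteq> C" if "C \<inter> B \<noteq> {}"
      using conn_closed_subset[of B "A \<union> B" C] that nt assms(2) by blast
    have "touch A B \<Longrightarrow> A \<subseteq> C \<Longrightarrow> C \<inter> B \<noteq> {}" "touch A B \<Longrightarrow> B \<subseteq> C \<Longrightarrow> C \<inter> A \<noteq> {}"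
      using nt adj_commute unfolding touch_iff by blast+
    then show False using 1 2 C assms(3) by blast
  qed
qed

lemma conn_insert: "conn A \<Longrightarrow> nbr x A \<Longrightarrow> conn (insert x A)"
  using conn_Un[of "{x}" A] adj_in_V by (fastforce simp: nbr_def)

lemma ex_comp:
  assumes "x \<in> S" "S \<subseteq> V"
  obtains C where "is_comp S C" "x \<in> C"
proof -
  \<comment> \<open>The component of \<open>x\<close> is the union of all connected subsets of
    \<open>S\<close> through \<open>x\<close>; a further neighbour in \<open>S\<close> could be
    adjoined and would already belong to it.\<close>
  let ?F = "{C. conn C \<and> x \<in> C \<and> C \<subseteq> S}"
  have "{x} \<in> ?F" using assms by auto
  then have c: "conn (\<Union>?F)" by (intro conn_Union) auto
  moreover have x: "x \<in> \<Union>?F" using \<open>{x} \<in> ?F\<close> by blast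
  moreover have "\<not> touch (\<Union>?F) (S - \<Union>?F)"
  proof
    assume "touch (\<Union>?F) (S - \<Union>?F)"
    then obtain y where y: "y \<in> S - \<Union>?F" "nbr y (\<Union>?F)"
      using touch_commute[of "\<Union>?F"] unfolding touch_def by blast
    then have "conn (insert y (\<Union>?F))" using conn_insert c by blast
    then have "insert y (\<Union>?F) \<in> ?F" using x y(1) by blast
    then show False using y(1) by blast
  qed
  ultimately show ?thesis using that[of "\<Union>?F"] unfolding is_comp_def by blast
qed

lemma is_compD:
  assumes "is_comp S C"
  shows "C \<subseteq> S" "conn C" "\<not> touch C (S - C)" "C \<noteq> {}" "C \<subseteq> V"
  using assms by (auto simp: is_comp_def dest: connD)

lemma comp_absorb: "is_comp S C \<Longrightarrow> conn K \<Longrightarrow> K \<subseteq> S \<Longrightarrow> K \<inter> C \<noteq> {} \<Longrightarrow> K \<subseteq> C"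
  using conn_closed_subset[of K S C] by (auto simp: is_comp_def)

lemma comp_disj: "is_comp S C \<Longrightarrow> is_comp S D \<Longrightarrow> C \<noteq> D \<Longrightarrow> C \<inter> D = {}"
  by (metis comp_absorb inf_commute is_compD(1,2) subset_antisym)

lemma comp_ntouch: "is_comp S C \<Longrightarrow> K \<subseteq> S \<Longrightarrow> K \<inter> C = {} \<Longrightarrow> \<not> touch C K \<and> \<not> touch K C"
  using touch_mono[of C K C "S - C"] is_compD(3)[of S C] touch_commute[of K C] by blast

lemma comps_ntouch: "is_comp S C \<Longrightarrow> is_comp S D \<Longrightarrow> C \<noteq> D \<Longrightarrow> \<not> touch C D \<and> C \<inter> D = {}"
  using comp_ntouch comp_disj is_compD(1) by (metis inf_commute)

text \<open>\<open>C\<close> is not all of \<open>S\<close>, so some edge leaves it inside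
  \<open>S\<close>, and that edge can only end in \<open>U\<close>. Mostly applied with
  \<open>U = {u}\<close>: then \<open>u\<close> is attached to every component of
  \<open>S - {u}\<close>.\<close>

lemma comp_touch:
  assumes "conn S" "is_comp (S - U) C" "S \<inter> U \<noteq> {}"
  shows "touch C (S \<inter> U)"
proof -
  have "C \<noteq> S" "C \<subseteq> S" using assms is_compD by blast+
  then have "touch C (S - C)" using conn_touch assms is_compD by metis
  then show ?thesis using is_compD(3)[OF assms(2)] by (auto simp: touch_iff)
qed

text \<open>The sets are the branch sets of a gem; \<open>H\<close> is that of the vertex of degree four.\<close>

definition gemfree :: bool where
  "gemfree \<longleftrightarrow> (\<forall>H P Q R S. conn H \<longrightarrow> conn P \<longrightarrow> conn Q \<longrightarrow> conn R \<longrightarrow> conn S \<longrightarrow>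
     H \<inter> (P \<union> Q \<union> R \<union> S) = {} \<longrightarrow> P \<inter> (Q \<union> R \<union> S) = {} \<longrightarrow> Q \<inter> (R \<union> S) = {} \<longrightarrow> R \<inter> S = {} \<longrightarrow>
     touch H P \<longrightarrow> touch H Q \<longrightarrow> touch H R \<longrightarrow> touch H S \<longrightarrow>
     touch P Q \<longrightarrow> touch Q R \<longrightarrow> touch R S \<longrightarrow>
     touch P R \<or> touch P S \<or> touch Q S)"

text \<open>The order of the sets is the same in all applications: hub first, then the four path
  sets in path order.\<close>

lemma gem_False:
  assumes "gemfree" "conn H" "conn P" "conn Q" "conn R" "conn S"
    "H \<inter> (P \<union> Q \<union> R \<union> S) = {}" "P \<inter> (Q \<union> R \<union> S) = {}" "Q \<inter> (R \<union> S) = {}" "R \<inter> S = {}"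
    "touch H P" "touch H Q" "touch H R" "touch H S" "touch P Q" "touch Q R" "touch R S"
    "\<not> touch P R" "\<not> touch P S" "\<not> touch Q S"
  shows False
  using assms(1)[unfolded gemfree_def, rule_format, OF assms(2-17)] assms(18-) by blast


lemma ntouch_sub: "\<not> touch A B \<Longrightarrow> A' \<subseteq> A \<Longrightarrow> B' \<subseteq> B \<Longrightarrow> \<not> touch A' B'"
  using touch_mono by blast

lemma touchI: "nbr x B \<Longrightarrow> x \<in> A \<Longrightarrow> touch A B"
  by (auto simp: touch_def)

lemma touchI2: "nbr x B \<Longrightarrow> x \<in> A \<Longrightarrow> touch B A"
  using touchI touch_commute by blast

lemma ntouch_elem: "\<not> touch A B \<Longrightarrow> x \<in> A \<Longrightarrow> \<not> nbr x B" "\<not> touch A B \<Longrightarrow> x \<in> B \<Longrightarrow> \<not> nbr x A"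
  using touchI touchI2 by blast+

definition two_connected :: bool where
  "two_connected \<longleftrightarrow> conn V \<and> 2 < card V \<and> (\<forall>v\<in>V. conn (V - {v}))"

text \<open>The usual form of 2-connectivity below: for a piece \<open>W\<close> with a known
  attachment \<open>x\<close> it provides a second one.\<close>

lemma two_connected_touch:
  assumes "two_connected" "W \<noteq> {}" "W \<subseteq> V - {x}" "V - {x} - W \<noteq> {}"
  shows "touch W (V - {x} - W)"
proof -
  have "conn (V - {x})" using assms(1) by (cases "x \<in> V") (auto simp: two_connected_def)
  then show ?thesis using conn_touch[of "V - {x}" W] assms by blast
qed

text \<open>Induced paths as vertex lists. The unspecified \<open>hd []\<close> is harmless, since
  the quantifier over \<open>set xs\<close> is then empty. The empty list is accepted, so
  \<open>xs \<noteq> []\<close> is demanded separately where it matters.\<close>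

fun ipath :: "'a list \<Rightarrow> bool" where
  "ipath [] \<longleftrightarrow> True"
| "ipath (x # xs) \<longleftrightarrow> x \<in> V \<and> x \<notin> set xs \<and> ipath xs \<and> (\<forall>y \<in> set xs. adj x y \<longleftrightarrow> y = hd xs)"

lemma ipath_append:
  "ipath (xs @ ys) \<longleftrightarrow> ipath xs \<and> ipath ys \<and> set xs \<inter> set ys = {} \<and>
     (\<forall>x \<in> set xs. \<forall>y \<in> set ys. adj x y \<longleftrightarrow> x = last xs \<and> y = hd ys)"
proof (induction xs)
  case (Cons x xs)
  show ?case
  proof (cases "xs = []")
    case False
    then have hl: "hd xs \<in> set xs" "last xs \<in> set xs" by auto
    have "(\<forall>y \<in> set ys. adj x y \<longleftrightarrow> y = hd xs) \<longleftrightarrow>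
        (\<forall>y \<in> set ys. adj x y \<longleftrightarrow> x = last xs \<and> y = hd ys)"
      if "x \<notin> set xs" "set xs \<inter> set ys = {}"
      using that hl by (intro ball_cong) auto
    then show ?thesis using Cons.IH False by (auto simp: ball_Un)
  qed auto
qed auto

lemma ipath_rev: "ipath (rev xs) \<longleftrightarrow> ipath xs"
proof (induction xs)
  case (Cons x xs)
  then show ?case
    by (cases "xs = []") (auto simp: ipath_append last_rev adj_commute[of _ x])
qed auto

lemma ipath_distinct: "ipath xs \<Longrightarrow> distinct xs"
  by (induction xs) auto

lemma ipath_V: "ipath xs \<Longrightarrow> set xs \<subseteq> V"
  by (induction xs) auto

lemma ipath_conn: "ipath xs \<Longrightarrow> xs \<noteq> [] \<Longrightarrow> conn (set xs)"
proof (induction xs)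
  case (Cons x xs)
  show ?case
  proof (cases "xs = []")
    case True
    then show ?thesis using Cons by auto
  next
    case False
    then have "nbr x (set xs)" using Cons.prems hd_in_set[of xs] by (auto simp: nbr_def)
    then show ?thesis using Cons False conn_insert by auto
  qed
qed auto

section \<open>Two-vertex cuts\<close>

text \<open>If the attached part \<open>B\<close> of \<open>D\<close> missed a vertex, a component
  \<open>K\<close> of \<open>D - B\<close> would have two neighbours \<open>b\<close>,
  \<open>y\<close> in \<open>B\<close> by 2-connectivity. This gives a gem with hub
  \<open>insert b A\<close> and path \<open>L\<close>, \<open>C\<close>, \<open>y\<close>,
  \<open>K\<close>.\<close>

lemma complete_comp:
  assumes gf: gemfree and tc: two_connected
    and cn: "conn A" "conn C" "conn L" "conn D"
    and dj: "A \<inter> C = {}" "(A \<union> C) \<inter> (L \<union> D) = {}" "L \<inter> D = {}"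
    and tL: "touch L A" "touch L C" and tD: "touch D A"
    and nD: "\<not> touch D (V - (A \<union> C \<union> D))"
    and eq: "\<And>x. x \<in> D \<Longrightarrow> nbr x A \<longleftrightarrow> nbr x C"
    and x: "x \<in> D"
  shows "nbr x A"
proof (rule ccontr)
  assume nx: "\<not> nbr x A"
  define B where "B = {x \<in> D. nbr x A}"
  have DV: "D \<subseteq> V" using cn connD by blast
  obtain K where K: "is_comp (D - B) K" "x \<in> K"
    using ex_comp[of x "D - B"] x nx DV by (auto simp: B_def)
  note Kd = is_compD[OF K(1)]
  have "D \<inter> B \<noteq> {}" using tD by (auto simp: B_def touch_def)
  then have "touch K (D \<inter> B)" using comp_touch[OF cn(4) K(1)] by blast
  then obtain b where b: "b \<in> B" "nbr b K"
    using touch_commute[of K] by (auto simp: touch_def)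
  obtain a where "a \<in> A" "a \<in> V" using connD[OF cn(1)] by blast
  then have "a \<in> V - {b} - K" using Kd b dj by (auto simp: B_def)
  then have "touch K (V - {b} - K)"
    using two_connected_touch[OF tc, of K b] Kd b by auto
  then obtain k y where ky: "k \<in> K" "y \<in> V" "y \<noteq> b" "y \<notin> K" "adj k y"
    by (auto simp: touch_iff)
  have kD: "k \<in> D" "\<not> nbr k A" "\<not> nbr k C" using ky Kd eq by (auto simp: B_def)
  have yD: "y \<in> D" using nD ky kD by (auto simp: touch_iff nbr_def)
  have yB: "y \<in> B"
  proof (rule ccontr)
    assume "y \<notin> B"
    then have "touch K (D - B - K)" using ky yD by (auto simp: touch_iff)
    then show False using Kd by blast
  qed
  have yK: "nbr y K" using ky adj_commute by (auto simp: nbr_def)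
  have LDn: "\<not> touch D L"
    using nD dj connD(2)[OF cn(3)] by (elim ntouch_sub) auto
  have bA: "nbr b A" "nbr b C" "b \<in> D" "nbr y A" "nbr y C" using b yB eq by (auto simp: B_def)
  have KC: "\<not> touch K C" using Kd eq by (auto simp: touch_def B_def)
  show False
  proof (rule gem_False[OF gf, of "insert b A" L C "{y}" K])
    show "conn (insert b A)" using conn_insert cn bA by blast
    show "touch (insert b A) {y}" "touch (insert b A) L" "touch (insert b A) C" "touch (insert b A) K"
      using bA b tL touch_commute by auto
    show "touch L C" "touch C {y}" "touch {y} K" using tL bA yK by auto
    show "\<not> touch L {y}" "\<not> touch L K"
      using ntouch_elem[OF LDn] yD ntouch_sub[OF LDn, of K L] Kd touch_commute[of L K] by auto
    show "\<not> touch C K" using KC touch_commute by blast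
  qed (use cn Kd ky bA yB yD dj b in \<open>auto simp: B_def\<close>)
qed

text \<open>\<open>M\<close> keeps \<open>A\<close> and \<open>C\<close> joined once \<open>L\<close> and \<open>D\<close> are removed; it is empty when \<open>A\<close>
  and \<open>C\<close> touch. Sets rather than vertices, so that \<open>A\<close> and \<open>C\<close> can absorb the ends of \<open>D\<close> in the
  induction of \<open>link_path\<close>.\<close>

definition link :: "'a set \<Rightarrow> 'a set \<Rightarrow> 'a set \<Rightarrow> 'a set \<Rightarrow> 'a set \<Rightarrow> bool" where
  "link A C M L D \<longleftrightarrow> conn A \<and> conn C \<and> conn L \<and> conn D \<and> conn (A \<union> M) \<and> conn (C \<union> M) \<and>
     touch (A \<union> M) C \<and> touch (C \<union> M) A \<and>
     A \<inter> C = {} \<and> (A \<union> C) \<inter> (M \<union> L \<union> D) = {} \<and> L \<inter> (M \<union> D) = {} \<and> M \<inter> D = {} \<and>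
     touch L A \<and> touch L C \<and> touch D A \<and> touch D C \<and> \<not> touch D (V - (A \<union> C \<union> D))"

lemma link_sym: "link A C M L D \<Longrightarrow> link C A M L D"
  by (auto simp: link_def Un_ac Int_ac)

lemma link_ntouch:
  assumes "link A C M L D"
  shows "\<not> touch D L" "\<not> touch D M"
proof -
  have "L \<subseteq> V" "M \<subseteq> V"
    using assms connD(2)[of L] connD(2)[of "A \<union> M"] by (auto simp: link_def)
  then have "L \<subseteq> V - (A \<union> C \<union> D)" "M \<subseteq> V - (A \<union> C \<union> D)"
    using assms unfolding link_def by blast+
  moreover have "\<not> touch D (V - (A \<union> C \<union> D))" using assms by (simp add: link_def)
  ultimately show "\<not> touch D L" "\<not> touch D M"
    using ntouch_sub by blast+
qed

text \<open>The hub \<open>A \<union> M\<close> reaches \<open>C\<close> even when \<open>A\<close>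
  alone does not; the path is \<open>U1\<close>, \<open>U2\<close>, \<open>C\<close>,
  \<open>L\<close>.\<close>

lemma link_gem:
  assumes gf: gemfree and lk: "link A C M L D"
    and U: "conn U1" "conn U2" "U1 \<subseteq> D" "U2 \<subseteq> D" "U1 \<inter> U2 = {}" "touch U1 U2"
    "touch U1 A" "\<not> touch U1 C" "touch U2 A" "touch U2 C"
  shows False
proof -
  note L = link_ntouch(1)[OF lk]
  have "\<not> touch U1 L" "\<not> touch U2 L" using ntouch_sub[OF L] U by auto
  then show False
    using lk U by (intro gem_False[OF gf, of "A \<union> M" U1 U2 C L])
      (auto simp: link_def touch_commute)
qed

text \<open>Let \<open>W\<close> be the component of \<open>D - {u}\<close> containing a second
  attached vertex \<open>x\<close>. If \<open>W\<close> reaches \<open>C\<close>, then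
  \<open>{u}\<close> and \<open>W\<close> feed \<open>link_gem\<close>; otherwise \<open>W\<close>
  does so together with \<open>insert u W2\<close>, where \<open>W2\<close> is a component that
  reaches \<open>C\<close>.\<close>

lemma link_single:
  assumes gf: gemfree and lk: "link A C M L D"
    and u: "u \<in> D" "nbr u A" "\<not> nbr u C" and x: "x \<in> D" "nbr x A"
  shows "x = u"
proof (rule ccontr)
  assume xu: "x \<noteq> u"
  have DV: "D \<subseteq> V" "conn D" using lk connD by (auto simp: link_def)
  obtain W where W: "is_comp (D - {u}) W" "x \<in> W"
    using ex_comp[of x "D - {u}"] x xu DV by auto
  note Wd = is_compD[OF W(1)]
  have Wu: "nbr u W" using comp_touch[OF DV(2) W(1)] u(1) by auto
  have WA: "touch W A" using x W touchI by blast
  show False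
  proof (cases "touch W C")
    case True
    show False
      by (rule link_gem[OF gf lk, of "{u}" W]) (use True Wu WA Wd u DV in auto)
  next
    case False
    obtain v where v: "v \<in> D" "nbr v C" using lk by (auto simp: link_def touch_def)
    then obtain W2 where W2: "is_comp (D - {u}) W2" "v \<in> W2"
      using ex_comp[of v "D - {u}"] u DV by auto
    note W2d = is_compD[OF W2(1)]
    have W2u: "nbr u W2" using comp_touch[OF DV(2) W2(1)] u(1) by auto
    have "touch W2 C" using v W2 touchI by blast
    then have "W \<noteq> W2" using False by blast
    then have "W \<inter> W2 = {}" using comp_disj W W2 by blast
    then show False
      using \<open>touch W2 C\<close> W2u Wu WA Wd W2d u DV False conn_insert
      by (intro link_gem[OF gf lk, of W "insert u W2"]) auto
  qed
qed

text \<open>\<open>D\<close> is peeled from both ends. If some vertex sees only one side,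
  \<open>link_single\<close> leaves unique attachments, \<open>u\<close> to \<open>A\<close> and
  \<open>v\<close> to \<open>C\<close>. Absorbing them into \<open>A\<close> and \<open>C\<close>
  reproduces the hypothesis on \<open>K = D - {u, v}\<close>, unless \<open>K\<close> is empty; the
  work lies in showing that \<open>K\<close> is connected.\<close>

lemma link_path:
  assumes gf: gemfree and tc: two_connected
  shows "link A C M L D \<Longrightarrow> (\<forall>x\<in>D. nbr x A \<and> nbr x C) \<or>
    (\<exists>xs. ipath xs \<and> set xs = D \<and> xs \<noteq> [] \<and>
      (\<forall>x\<in>D. (nbr x A \<longleftrightarrow> x = hd xs) \<and> (nbr x C \<longleftrightarrow> x = last xs)))"
proof (induction "card D" arbitrary: A C D rule: less_induct)
  case (less D A C)
  note lk = less.prems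
  have DV: "D \<subseteq> V" "conn D" using lk connD by (auto simp: link_def)
  have finD: "finite D" using DV finite_V finite_subset by blast
  note sA = link_single[OF gf lk] and sC = link_single[OF gf link_sym[OF lk]]
  obtain x0 y0 where x0: "x0 \<in> D" "nbr x0 A" and y0: "y0 \<in> D" "nbr y0 C"
    using lk by (auto simp: link_def touch_def)
  show ?case
  proof (cases "\<forall>x\<in>D. nbr x A \<longleftrightarrow> nbr x C")
    case True
    have "nbr x A" if "x \<in> D" for x
      by (rule complete_comp[OF gf tc, of A C L D])
        (use lk True that in \<open>auto simp: link_def\<close>)
    then show ?thesis using True by blast
  next
    case False
    have "\<exists>u v. u \<in> D \<and> v \<in> D \<and> u \<noteq> v \<and> (\<forall>x\<in>D. nbr x A \<longleftrightarrow> x = u) \<and> (\<forall>x\<in>D. nbr x C \<longleftrightarrow> x = v)"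
      using False sA sC x0 y0 by metis
    then obtain u v where uv: "u \<in> D" "v \<in> D" "u \<noteq> v"
      and uA: "\<And>x. x\<in>D \<Longrightarrow> nbr x A \<longleftrightarrow> x = u" and vC: "\<And>x. x\<in>D \<Longrightarrow> nbr x C \<longleftrightarrow> x = v"
      by blast
    define K where "K = D - {u, v}"
    note LDn = link_ntouch(1)[OF lk]
    have outer: "y \<in> D" if "x \<in> K" "adj x y" for x y
    proof -
      have "x \<in> D" "\<not> nbr x A" "\<not> nbr x C" using that uA vC by (auto simp: K_def)
      moreover have "y \<in> V" using that adj_in_V by blast
      moreover have "\<not> touch D (V - (A \<union> C \<union> D))" using lk by (auto simp: link_def)
      ultimately show ?thesis using that(2) by (auto simp: touch_iff nbr_def)
    qed
    \<comment> \<open>Everything next to a component of \<open>K\<close> is \<open>u\<close> or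
      \<open>v\<close>, so if one were missed the other would be a cut vertex.\<close>
    have both: "nbr u W \<and> nbr v W" if W: "is_comp K W" for W
    proof -
      note Wd = is_compD[OF W]
      have out: "y = u \<or> y = v" if "x \<in> W" "adj x y" "y \<notin> W" for x y
        using outer[of x y] that Wd(1,3) by (fastforce simp: K_def touch_iff)
      have *: "nbr q W" if "{p, q} = {u, v}" for p q
      proof -
        have "p \<in> {u, v}" "q \<in> {u, v}" "p \<noteq> q" using that uv by auto
        then have "q \<in> V - {p} - W" "W \<subseteq> V - {p}" using Wd uv DV by (auto simp: K_def)
        then have "touch W (V - {p} - W)"
          using two_connected_touch[OF tc, of W p] Wd by blast
        then obtain x y where "x \<in> W" "adj x y" "y \<notin> W" "y \<noteq> p" by (auto simp: touch_iff)
        then have "y = q" using out that by (metis doubleton_eq_iff)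
        then show ?thesis using \<open>x \<in> W\<close> \<open>adj x y\<close> adj_commute by (auto simp: nbr_def)
      qed
      show ?thesis using *[of u v] *[of v u] by blast
    qed
    have uA': "nbr u A" "nbr v C" using uA vC uv by auto
    have AM: "touch (insert u (A \<union> M)) C" "conn (insert u (A \<union> M))" "touch (insert u (A \<union> M)) L"
      using lk uA' conn_insert[of "A \<union> M" u] by (auto simp: link_def touch_commute)
    show ?thesis
    proof (cases "K = {}")
      case True
      then have D: "D = {u, v}" using uv by (auto simp: K_def)
      then have "adj u v" using conn_touch[OF DV(2), of "{u}"] uv by (auto simp: insert_Diff_if adj_commute)
      then have "ipath [u, v]" using uv DV by auto
      then show ?thesis using uA vC D by (intro disjI2 exI[of _ "[u, v]"]) auto
    next
      case False
      have KV: "K \<subseteq> V" using DV by (auto simp: K_def)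
      have KC: "\<not> touch K C" "\<not> touch K A" using uA vC by (auto simp: touch_def K_def)
      have KL: "\<not> touch K L" using ntouch_sub[OF LDn] by (auto simp: K_def)
      have vL: "\<not> nbr v L" using ntouch_elem[OF LDn] uv by auto
      have g: "touch (insert u (A \<union> M) \<union> N) L" "touch (insert u (A \<union> M) \<union> N) C" for N
        using AM by (auto simp: touch_commute)
      \<comment> \<open>\<open>N\<close> is a way from \<open>u\<close> to \<open>v\<close> besides
        \<open>W\<close>, or is empty if they are adjacent. The path is \<open>W\<close>,
        \<open>v\<close>, \<open>C\<close>, \<open>L\<close>. This excludes the edge between
        \<open>u\<close> and \<open>v\<close> and also a second component of
        \<open>K\<close>.\<close>
      have gem: False
        if "conn W" "W \<subseteq> K" "nbr u W" "nbr v W" "N \<subseteq> K" "N \<inter> W = {}" "adj u v \<or> nbr v N"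
          "conn (insert u (A \<union> M) \<union> N)" for W N
      proof (rule gem_False[OF gf, of "insert u (A \<union> M) \<union> N" W "{v}" C L])
        show "touch (insert u (A \<union> M) \<union> N) {v}" using that(7) adj_commute by auto
        show "\<not> touch W C" "\<not> touch W L" "\<not> touch {v} L"
          using that ntouch_sub KC KL vL by auto
      qed (use that lk uv uA' DV g in \<open>auto simp: link_def K_def touch_commute[of L C]\<close>)
      have nuv: "\<not> adj u v"
      proof
        assume a: "adj u v"
        obtain x where "x \<in> K" using False by blast
        then obtain W where W: "is_comp K W" using ex_comp KV by metis
        then show False using gem[of W "{}"] is_compD[OF W] both[OF W] AM a by auto
      qed
      have dis: "W1 \<inter> W2 \<noteq> {}" if "conn W1" "W1 \<subseteq> K" "nbr u W1" "nbr v W1"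
         "conn W2" "W2 \<subseteq> K" "nbr u W2" "nbr v W2" for W1 W2
        using gem[of W1 W2] that conn_Un[of "insert u (A \<union> M)" W2] AM by auto
      have Kc: "conn K"
      proof -
        obtain x where "x \<in> K" using False by blast
        then obtain W where W: "is_comp K W" using ex_comp KV by metis
        have "W = K"
        proof (rule ccontr)
          assume "W \<noteq> K"
          then obtain y where "y \<in> K" "y \<notin> W" using is_compD(1)[OF W] by blast
          then obtain W2 where W2: "is_comp K W2" "y \<in> W2" using ex_comp KV by metis
          then show False
            using dis[of W W2] both W is_compD comp_disj[OF W W2(1)] \<open>y \<notin> W\<close> by blast
        qed
        then show ?thesis using is_compD W by blast
      qed
      have Kcomp: "is_comp K K" using Kc by (auto simp: is_comp_def)
      have lk2: "link (insert u A) (insert v C) M L K"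
      proof -
        have "\<not> touch K (V - (insert u A \<union> insert v C \<union> K))"
          using outer by (auto simp: touch_iff K_def)
        moreover have "conn (insert v (C \<union> M))" "conn (insert v C)" "conn (insert u A)"
          using lk uA' conn_insert by (auto simp: link_def)
        ultimately show ?thesis
          using lk uv uA' AM both[OF Kcomp] Kc
          unfolding link_def by (auto simp: K_def)
      qed
      have "card K < card D" using finD uv by (intro psubset_card_mono) (auto simp: K_def)
      from less.hyps[OF this lk2] have "\<exists>xs. ipath xs \<and> set xs = K \<and> xs \<noteq> [] \<and>
        (\<forall>x\<in>K. (adj x u \<longleftrightarrow> x = hd xs) \<and> (adj x v \<longleftrightarrow> x = last xs))"
      proof
        \<comment> \<open>Here two distinct vertices of \<open>K\<close> would be two disjoint links
          between \<open>u\<close> and \<open>v\<close>, so \<open>K\<close> is one vertex, which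
          still counts as a path.\<close>
        assume "\<forall>x\<in>K. nbr x (insert u A) \<and> nbr x (insert v C)"
        then have a: "adj x u" "adj x v" if "x \<in> K" for x
          using that uA vC by (auto simp: K_def)
        obtain k where k: "k \<in> K" using False by blast
        have "k' = k" if "k' \<in> K" for k'
          using dis[of "{k}" "{k'}"] that k a KV adj_commute by auto
        then have "K = {k}" using k by blast
        then show ?thesis using a k KV by (intro exI[of _ "[k]"]) auto
      next
        assume "\<exists>xs. ipath xs \<and> set xs = K \<and> xs \<noteq> [] \<and> (\<forall>x\<in>K. nbr x (insert u A) = (x = hd xs) \<and> nbr x (insert v C) = (x = last xs))"
        moreover have "nbr x (insert u A) \<longleftrightarrow> adj x u" "nbr x (insert v C) \<longleftrightarrow> adj x v" if "x \<in> K" for x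
          using that uA vC by (auto simp: K_def)
        ultimately show ?thesis by auto
      qed
      then obtain xs where xs: "ipath xs" "set xs = K" "xs \<noteq> []"
        "\<And>x. x \<in> K \<Longrightarrow> adj x u \<longleftrightarrow> x = hd xs" "\<And>x. x \<in> K \<Longrightarrow> adj x v \<longleftrightarrow> x = last xs"
        by blast
      have "ipath (u # xs @ [v])"
        using xs uv DV nuv by (auto simp: ipath_append adj_commute K_def)
      moreover have "set (u # xs @ [v]) = D" using xs uv by (auto simp: K_def)
      ultimately show ?thesis
        using uA vC by (intro disjI2 exI[of _ "u # xs @ [v]"]) auto
    qed
  qed
qed

section \<open>Good pieces and thick cuts\<close>

definition P4 :: "'a \<Rightarrow> 'a \<Rightarrow> 'a \<Rightarrow> 'a \<Rightarrow> bool" where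
  "P4 p q r s \<longleftrightarrow> adj p q \<and> adj q r \<and> adj r s \<and> \<not> adj p r \<and> \<not> adj p s \<and> \<not> adj q s"

definition p4free :: "'a set \<Rightarrow> bool" where
  "p4free S \<longleftrightarrow> (\<forall>p\<in>S. \<forall>q\<in>S. \<forall>r\<in>S. \<forall>s\<in>S. \<not> P4 p q r s)"

text \<open>\<open>butlast (tl xs)\<close> lists the internal vertices; their degree is taken in the
  whole graph, not in \<open>S\<close>.\<close>

definition good :: "'a set \<Rightarrow> bool" where
  "good S \<longleftrightarrow> p4free S \<or> (\<exists>xs. ipath xs \<and> xs \<noteq> [] \<and> set xs = S \<and>
     (\<forall>x \<in> set (butlast (tl xs)). card {y. adj x y} = 2))"

definition thick_cut :: "'a \<Rightarrow> 'a \<Rightarrow> bool" where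
  "thick_cut a c \<longleftrightarrow> a \<in> V \<and> c \<in> V \<and> a \<noteq> c \<and>
     (\<exists>D1 D2. is_comp (V - {a, c}) D1 \<and> is_comp (V - {a, c}) D2 \<and> D1 \<noteq> D2 \<and>
       (adj a c \<or> (\<exists>D3. is_comp (V - {a, c}) D3 \<and> D3 \<noteq> D1 \<and> D3 \<noteq> D2)))"

lemma P4_distinct: "P4 p q r s \<Longrightarrow> distinct [p, q, r, s]"
  unfolding P4_def using adj_commute by (auto; metis adj_irrefl)

lemma P4_V: "P4 p q r s \<Longrightarrow> p \<in> V \<and> q \<in> V \<and> r \<in> V \<and> s \<in> V"
  unfolding P4_def using adj_in_V by blast

text \<open>A \<open>P4\<close> inside \<open>S\<close> would be the path of a gem with hub
  \<open>H\<close>.\<close>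

lemma dominated_p4free:
  assumes gf: gemfree and H: "conn H" "H \<inter> S = {}" "\<And>x. x \<in> S \<Longrightarrow> nbr x H"
  shows "p4free S"
  unfolding p4free_def
proof (intro ballI notI)
  fix p q r s assume S: "p \<in> S" "q \<in> S" "r \<in> S" "s \<in> S" and P: "P4 p q r s"
  show False
    by (rule gem_False[OF gf, of H "{p}" "{q}" "{r}" "{s}"])
      (use P4_distinct[OF P] P4_V[OF P] P S H in \<open>auto simp: P4_def adj_commute touch_commute\<close>)
qed

lemma ipath_inner_degree:
  assumes "ipath xs" "x \<in> set (butlast (tl xs))" "\<And>y. adj x y \<Longrightarrow> y \<in> set xs"
  shows "card {y. adj x y} = 2"
proof -
  obtain h where h: "xs = h # tl xs" using assms(2) by (cases xs) auto
  obtain s t where st: "butlast (tl xs) = s @ x # t" using assms(2) split_list by metis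
  have "tl xs \<noteq> []" using assms(2) by auto
  then have "tl xs = (s @ x # t) @ [last (tl xs)]" using st append_butlast_last_id by metis
  then have xs: "xs = (h # s) @ x # (t @ [last (tl xs)])" using h by simp
  then obtain s' t' where s': "xs = s' @ x # t'" "s' \<noteq> []" "t' \<noteq> []" by blast
  have "\<forall>y\<in>set s'. adj x y \<longleftrightarrow> y = last s'" "\<forall>y\<in>set t'. adj x y \<longleftrightarrow> y = hd t'"
    using assms(1) s' adj_commute[of x] by (auto simp: ipath_append)
  moreover have "y \<in> set s' \<or> y \<in> set t'" if "adj x y" for y
    using assms(3)[OF that] s'(1) that by auto
  ultimately have "adj x y \<longleftrightarrow> y = last s' \<or> y = hd t'" for y
    using last_in_set[OF s'(2)] hd_in_set[OF s'(3)] by metis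
  then have "{y. adj x y} = {last s', hd t'}" by blast
  moreover have "last s' \<noteq> hd t'"
  proof -
    have "set s' \<inter> set t' = {}" using assms(1) s'(1) by (auto simp: ipath_append)
    then show ?thesis using last_in_set[OF s'(2)] hd_in_set[OF s'(3)] by (metis disjoint_iff)
  qed
  ultimately show ?thesis by simp
qed

lemma inner_not_ends:
  assumes "distinct xs" "x \<in> set (butlast (tl xs))"
  shows "x \<in> set xs" "x \<noteq> hd xs" "x \<noteq> last xs"
proof -
  have ne: "xs \<noteq> []" "tl xs \<noteq> []" using assms(2) by (cases xs; auto)+
  have x: "x \<in> set (tl xs)" using assms(2) in_set_butlastD by metis
  then show "x \<in> set xs" "x \<noteq> hd xs" using assms(1) ne by (cases xs; auto)+
  have "tl xs = butlast (tl xs) @ [last (tl xs)]" using ne by simp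
  moreover have "distinct (tl xs)" using assms(1) distinct_tl by blast
  ultimately have "x \<noteq> last (tl xs)" using assms(2)
    by (metis Int_iff distinct_append empty_iff list.set_intros(1))
  then show "x \<noteq> last xs" using ne by (simp add: last_tl)
qed

text \<open>Otherwise the other vertex of the pair would be a cut vertex.\<close>

lemma cut_comp_nbrs:
  assumes tc: two_connected and W: "is_comp (V - {a, c}) W" and ac: "a \<in> V" "c \<in> V" "a \<noteq> c"
  shows "nbr a W" "nbr c W"
proof -
  note Wd = is_compD[OF W]
  have *: "nbr q W" if "{p, q} = {a, c}" for p q
  proof -
    have "p \<in> {a, c}" "q \<in> {a, c}" "p \<noteq> q" using that ac by auto
    then have "q \<in> V - {p} - W" "W \<subseteq> V - {p}" using Wd ac by auto
    then have "touch W (V - {p} - W)" using two_connected_touch[OF tc, of W p] Wd by blast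
    then obtain x y where xy: "x \<in> W" "adj x y" "y \<notin> W" "y \<noteq> p" "y \<in> V" by (auto simp: touch_iff)
    then have "y = q" using Wd(3) that by (auto simp: touch_iff)
    then show ?thesis using xy adj_commute by (auto simp: nbr_def)
  qed
  show "nbr a W" "nbr c W" using *[of c a] *[of a c] by blast+
qed

text \<open>The last hypothesis supplies the connecting set of \<open>link\<close>: empty when
  \<open>a\<close> and \<open>c\<close> are adjacent, otherwise a third component.\<close>

lemma cut_good:
  assumes gf: gemfree and tc: two_connected and ac: "a \<in> V" "c \<in> V" "a \<noteq> c"
    and D: "is_comp (V - {a, c}) D" and L: "is_comp (V - {a, c}) L" "L \<noteq> D"
    and M: "adj a c \<or> (\<exists>M. is_comp (V - {a, c}) M \<and> M \<noteq> D \<and> M \<noteq> L)"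
  shows "good D"
proof -
  note nD = cut_comp_nbrs[OF tc D ac] and nL = cut_comp_nbrs[OF tc L(1) ac]
  note Dd = is_compD[OF D] and Ld = is_compD[OF L(1)]
  have out: "\<not> touch D (V - ({a} \<union> {c} \<union> D))"
    using Dd by (elim ntouch_sub) auto
  have "\<exists>M. link {a} {c} M L D"
  proof (cases "adj a c")
    case True
    then have "link {a} {c} {} L D"
      using nD nL Dd Ld ac comp_disj[OF L(1) D] L(2) out
      by (auto simp: link_def adj_commute)
    then show ?thesis by blast
  next
    case False
    then obtain M where M: "is_comp (V - {a, c}) M" "M \<noteq> D" "M \<noteq> L" using assms by blast
    note nM = cut_comp_nbrs[OF tc M(1) ac] and Md = is_compD[OF M(1)]
    have "link {a} {c} M L D"
      using nD nL nM Dd Ld Md ac comp_disj[OF L(1) D] comp_disj[OF M(1) D]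
        comp_disj[OF L(1) M(1)] M(2,3) L(2) out conn_insert[OF Md(2) nM(1)] conn_insert[OF Md(2) nM(2)]
      by (auto simp: link_def)
    then show ?thesis by blast
  qed
  then obtain M where lk: "link {a} {c} M L D" by blast
  from link_path[OF gf tc lk] show ?thesis
  proof
    assume "\<forall>x\<in>D. nbr x {a} \<and> nbr x {c}"
    then show ?thesis
      using dominated_p4free[OF gf, of "{a}" D] ac Dd(1) by (auto simp: good_def)
  next
    assume "\<exists>xs. ipath xs \<and> set xs = D \<and> xs \<noteq> [] \<and> (\<forall>x\<in>D. nbr x {a} = (x = hd xs) \<and> nbr x {c} = (x = last xs))"
    then obtain xs where xs: "ipath xs" "set xs = D" "xs \<noteq> []"
      "\<And>x. x\<in>D \<Longrightarrow> adj x a = (x = hd xs)" "\<And>x. x \<in> D \<Longrightarrow> adj x c = (x = last xs)" by auto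
    have "card {y. adj x y} = 2" if x: "x \<in> set (butlast (tl xs))" for x
    proof (rule ipath_inner_degree[OF xs(1) x])
      fix y assume y: "adj x y"
      note e = inner_not_ends[OF ipath_distinct[OF xs(1)] x]
      have "y \<noteq> a" "y \<noteq> c" "x \<in> D" "y \<in> V" using e y xs adj_in_V by auto
      then show "y \<in> set xs" using y Dd(3) xs(2) by (auto simp: touch_iff)
    qed
    then show ?thesis using xs by (auto simp: good_def)
  qed
qed

lemma thick_cut_good:
  assumes gf: gemfree and tc: two_connected and cut: "thick_cut a c"
    and D: "is_comp (V - {a, c}) D"
  shows "good D"
proof -
  from cut obtain D1 D2 where D12: "is_comp (V - {a, c}) D1" "is_comp (V - {a, c}) D2" "D1 \<noteq> D2"
    and ac: "a \<in> V" "c \<in> V" "a \<noteq> c"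
    and D3: "adj a c \<or> (\<exists>D3. is_comp (V - {a, c}) D3 \<and> D3 \<noteq> D1 \<and> D3 \<noteq> D2)"
    unfolding thick_cut_def by blast
  \<comment> \<open>\<open>D\<close> may or may not be one of the components witnessing the thick
    cut, so the roles of \<open>L\<close> and of the third component are reassigned around
    it.\<close>
  obtain L where L: "is_comp (V - {a, c}) L" "L \<noteq> D"
    "adj a c \<or> (\<exists>M. is_comp (V - {a, c}) M \<and> M \<noteq> D \<and> M \<noteq> L)"
  proof (cases "D = D1")
    case True
    then show ?thesis using that[of D2] D12 D3 by blast
  next
    case False
    show ?thesis
    proof (cases "D = D2")
      case True
      then show ?thesis using that[of D1] D12 D3 by metis
    next
      case False
      then show ?thesis using that[of D1] \<open>D \<noteq> D1\<close> D12 by metis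
    qed
  qed
  show ?thesis by (rule cut_good[OF gf tc ac D L])
qed

lemma comp_inside:
  assumes "S \<subseteq> V" "A \<subseteq> S" "A \<noteq> {}" "\<not> touch A (S - A)"
  obtains W where "is_comp S W" "W \<subseteq> A"
proof -
  obtain x where "x \<in> A" using assms by blast
  then obtain W where W: "is_comp S W" "x \<in> W" using ex_comp[of x S] assms by blast
  then have "W \<subseteq> A"
    using conn_closed_subset[of W S A] is_compD[OF W(1)] \<open>x \<in> A\<close> assms(4) by blast
  then show ?thesis using that W by blast
qed

text \<open>Closed sets suffice in place of components, since \<open>comp_inside\<close> finds a
  component in each of them. \<open>thick_cutI3\<close> is the counterpart for pairs not known to be
  adjacent.\<close>

lemma thick_cutI2:
  assumes "adj a c" "A \<noteq> {}" "A \<subseteq> V - {a, c}" "V - {a, c} - A \<noteq> {}"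
    "\<not> touch A (V - {a, c} - A)"
  shows "thick_cut a c"
proof -
  let ?S = "V - {a, c}"
  obtain W1 where 1: "is_comp ?S W1" "W1 \<subseteq> A" using comp_inside[of ?S A] assms by blast
  have "?S - (?S - A) = A" using assms by blast
  then have "\<not> touch (?S - A) (?S - (?S - A))" using assms touch_commute by metis
  then obtain W2 where 2: "is_comp ?S W2" "W2 \<subseteq> ?S - A"
    using comp_inside[of ?S "?S - A"] assms by blast
  have "W1 \<noteq> W2" using 1 2 is_compD(4)[OF 1(1)] by blast
  then show ?thesis using 1 2 assms(1) adj_in_V[OF assms(1)] unfolding thick_cut_def by fastforce
qed

lemma thick_cutI3:
  assumes "a \<in> V" "c \<in> V" "a \<noteq> c" "A \<noteq> {}" "B \<noteq> {}" "A \<inter> B = {}" "A \<union> B \<subseteq> V - {a, c}"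
    "V - {a, c} - A - B \<noteq> {}" "\<not> touch A (V - {a, c} - A)" "\<not> touch B (V - {a, c} - B)"
  shows "thick_cut a c"
proof -
  let ?S = "V - {a, c}"
  obtain W1 where 1: "is_comp ?S W1" "W1 \<subseteq> A" using comp_inside[of ?S A] assms by blast
  obtain W2 where 2: "is_comp ?S W2" "W2 \<subseteq> B" using comp_inside[of ?S B] assms by blast
  have "\<not> touch (?S - A - B) (?S - (?S - A - B))"
    using assms(7,9,10) adj_commute by (fastforce simp: touch_iff)
  then obtain W3 where 3: "is_comp ?S W3" "W3 \<subseteq> ?S - A - B"
    using comp_inside[of ?S "?S - A - B"] assms by blast
  have "W1 \<noteq> W2" "W1 \<noteq> W3" "W2 \<noteq> W3"
    using 1 2 3 is_compD(4)[OF 1(1)] is_compD(4)[OF 2(1)] assms(6) by blast+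
  then show ?thesis using 1 2 3 assms(1-3) unfolding thick_cut_def by metis
qed

section \<open>Induced paths and holes\<close>

lemma ipath_app_touch: "ipath (s @ t) \<Longrightarrow> s \<noteq> [] \<Longrightarrow> t \<noteq> [] \<Longrightarrow> touch (set s) (set t)"
  using hd_in_set[of t] last_in_set[of s] by (auto simp: ipath_append touch_iff)

lemma ipath_app_ntouch: "ipath (s @ m @ t) \<Longrightarrow> m \<noteq> [] \<Longrightarrow> \<not> touch (set s) (set t)"
  by (cases m) (auto simp: ipath_append touch_iff)

text \<open>No distance is used. Delete a vertex \<open>s\<close> of \<open>S\<close> and recurse
  into the component \<open>W\<close> of a target. If \<open>W\<close> meets \<open>S\<close> again,
  \<open>s\<close> is forgotten; otherwise the neighbours of \<open>s\<close> become the new source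
  set and \<open>s\<close> is put in front.\<close>

lemma shortest_path:
  assumes "conn D" "S \<inter> D \<noteq> {}" "T \<inter> D \<noteq> {}"
  shows "\<exists>xs. ipath xs \<and> xs \<noteq> [] \<and> set xs \<subseteq> D \<and> (\<forall>x\<in>set xs. x \<in> S \<longleftrightarrow> x = hd xs) \<and>
    (\<forall>x\<in>set xs. x \<in> T \<longleftrightarrow> x = last xs)"
  using assms
proof (induction "card D" arbitrary: D S rule: less_induct)
  case less
  have DV: "D \<subseteq> V" using less.prems(1) connD by blast
  have finD: "finite D" using DV finite_V finite_subset by blast
  show ?case
  proof (cases "S \<inter> T \<inter> D = {}")
    case False
    then obtain x where "x \<in> S \<inter> T \<inter> D" by blast
    then show ?thesis using DV by (intro exI[of _ "[x]"]) auto
  next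
    case True
    obtain s t where s: "s \<in> S" "s \<in> D" and t: "t \<in> T" "t \<in> D" using less.prems(2,3) by blast
    then have "t \<noteq> s" using True by blast
    then obtain W where W: "is_comp (D - {s}) W" "t \<in> W"
      using ex_comp[of t "D - {s}"] t DV by blast
    note Wd = is_compD[OF W(1)]
    have sW: "nbr s W" using comp_touch[OF less.prems(1) W(1)] s by auto
    have cW: "card W < card D" using Wd s finD by (intro psubset_card_mono) auto
    have tW: "T \<inter> W \<noteq> {}" using t W by blast
    show ?thesis
    proof (cases "S \<inter> W = {}")
      case False
      then show ?thesis using less.hyps[OF cW Wd(2) False tW] Wd(1) by blast
    next
      case True
      have "{x. adj s x} \<inter> W \<noteq> {}" using sW by (auto simp: nbr_def)
      from less.hyps[OF cW Wd(2) this tW] obtain xs where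
        xs: "ipath xs" "xs \<noteq> []" "set xs \<subseteq> W" "\<And>x. x \<in> set xs \<Longrightarrow> adj s x \<longleftrightarrow> x = hd xs"
          "\<And>x. x \<in> set xs \<Longrightarrow> x \<in> T \<longleftrightarrow> x = last xs" by auto
      have "s \<notin> set xs" "s \<notin> T" using xs Wd \<open>S \<inter> T \<inter> D = {}\<close> s by auto
      moreover have "s \<noteq> last xs" using \<open>s \<notin> set xs\<close> xs(2) by auto
      ultimately show ?thesis
        using xs s DV Wd(1) True by (intro exI[of _ "s # xs"]) auto
    qed
  qed
qed

lemma split_first:
  assumes "Suc n \<le> card {x \<in> set xs. P x}"
  shows "\<exists>s t. xs = s @ t \<and> (\<exists>x\<in>set s. P x) \<and> n \<le> card {x \<in> set t. P x}"
proof -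
  have "{x \<in> set xs. P x} \<noteq> {}" using assms by (metis card.empty not_less_eq_eq zero_le)
  then obtain ys x zs where xs: "xs = ys @ x # zs" "P x" "\<forall>y\<in>set ys. \<not> P y"
    using split_list_first_prop[of xs P] by blast
  then have "{x \<in> set xs. P x} \<subseteq> insert x {x \<in> set zs. P x}" by auto
  then have "card {x \<in> set xs. P x} \<le> card (insert x {x \<in> set zs. P x})" by (intro card_mono) auto
  also have "\<dots> \<le> Suc (card {x \<in> set zs. P x})" by (rule card_insert_le_m1) auto
  finally show ?thesis using assms xs by (intro exI[of _ "ys @ [x]"] exI[of _ zs]) auto
qed

text \<open>Repeated use of \<open>split_first\<close> cuts the path into four consecutive segments,
  each containing a vertex attached to \<open>H\<close>. They form the path of a gem with hub
  \<open>H\<close>.\<close>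

lemma fan:
  assumes gf: gemfree and p: "ipath xs" and H: "conn H" "H \<inter> set xs = {}"
    and c: "4 \<le> card {x \<in> set xs. nbr x H}"
  shows False
proof -
  have "Suc (Suc (Suc (Suc 0))) \<le> card {x \<in> set xs. nbr x H}" using c by simp
  then obtain s1 t1 where 1: "xs = s1 @ t1" "\<exists>x\<in>set s1. nbr x H"
    "Suc (Suc (Suc 0)) \<le> card {x \<in> set t1. nbr x H}"
    using split_first[of _ xs "\<lambda>x. nbr x H"] by blast
  obtain s2 t2 where 2: "t1 = s2 @ t2" "\<exists>x\<in>set s2. nbr x H" "Suc (Suc 0) \<le> card {x \<in> set t2. nbr x H}"
    using split_first[OF 1(3)] by blast
  obtain s3 t3 where 3: "t2 = s3 @ t3" "\<exists>x\<in>set s3. nbr x H" "Suc 0 \<le> card {x \<in> set t3. nbr x H}"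
    using split_first[OF 2(3)] by blast
  define s4 where "s4 = t3"
  have "{x \<in> set t3. nbr x H} \<noteq> {}" using 3(3) by (metis card.empty not_less_eq_eq zero_le)
  then have 4: "\<exists>x\<in>set s4. nbr x H" by (auto simp: s4_def)
  have xs: "xs = s1 @ s2 @ s3 @ s4" using 1 2 3 by (simp add: s4_def)
  have ne: "s1 \<noteq> []" "s2 \<noteq> []" "s3 \<noteq> []" "s4 \<noteq> []" using 1 2 3 4 by auto
  have ip: "ipath s1" "ipath s2" "ipath s3" "ipath s4" "ipath (s1 @ s2)" "ipath (s2 @ s3)" "ipath (s3 @ s4)"
    "ipath (s1 @ s2 @ s3)" "ipath (s1 @ (s2 @ s3) @ s4)" "ipath (s2 @ s3 @ s4)"
    using p unfolding xs by (auto simp: ipath_append ne)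
  show False
  proof (rule gem_False[OF gf, of H "set s1" "set s2" "set s3" "set s4"])
    show "conn (set s1)" "conn (set s2)" "conn (set s3)" "conn (set s4)"
      using ip ne ipath_conn by auto
    show "touch (set s1) (set s2)" "touch (set s2) (set s3)" "touch (set s3) (set s4)"
      using ip ne ipath_app_touch by auto
    show "\<not> touch (set s1) (set s3)" "\<not> touch (set s1) (set s4)" "\<not> touch (set s2) (set s4)"
      using ip ne ipath_app_ntouch by blast+
    show "touch H (set s1)" "touch H (set s2)" "touch H (set s3)" "touch H (set s4)"
      using 1 2 3 4 touchI2 by blast+
  qed (use H p xs in \<open>auto simp: ipath_append\<close>)
qed

section \<open>Long holes and the components attached to them\<close>

text \<open>The hole is the cyclic sequence \<open>b # xs\<close>, so its length is at least five.\<close>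

definition hole :: "'a \<Rightarrow> 'a list \<Rightarrow> bool" where
  "hole b xs \<longleftrightarrow> b \<in> V \<and> ipath xs \<and> 4 \<le> length xs \<and> b \<notin> set xs \<and>
     (\<forall>y\<in>set xs. adj b y \<longleftrightarrow> y = hd xs \<or> y = last xs)"

lemma hole_rotate: "hole b (x # xs) \<Longrightarrow> hole x (xs @ [b])"
  unfolding hole_def by (auto simp: ipath_append adj_commute)

lemma hole_rotate_at: "hole b (s @ y # t) \<Longrightarrow> hole y (t @ b # s)"
proof (induction s arbitrary: b t)
  case Nil
  then show ?case using hole_rotate by simp
next
  case (Cons x s)
  then have "hole x (s @ y # (t @ [b]))" using hole_rotate[of b x "s @ y # t"] by simp
  from Cons.IH[OF this] show ?case by simp
qed

lemma hole_rotate_to: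
  assumes "hole b xs" "y \<in> insert b (set xs)"
  obtains ys where "hole y ys" "insert y (set ys) = insert b (set xs)"
proof (cases "y = b")
  case True
  then show ?thesis using that assms by blast
next
  case False
  then obtain s t where xs: "xs = s @ y # t" using assms(2) split_list by fastforce
  then show ?thesis using that[of "t @ b # s"] hole_rotate_at assms(1) by auto
qed

lemma hole_rev: "hole b xs \<Longrightarrow> hole b (rev xs)"
  unfolding hole_def by (auto simp: ipath_rev hd_rev last_rev)

text \<open>Let \<open>Q\<close> be the component of \<open>W - set t\<close> containing
  \<open>s\<close>, and cut \<open>t\<close> into nonempty halves \<open>t1\<close>,
  \<open>t2\<close>. As \<open>W\<close> is connected, \<open>Q\<close> reaches one half: either the
  hub is \<open>insert x Q\<close> with path \<open>K\<close>, \<open>y\<close>, \<open>t1\<close>,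
  \<open>t2\<close>, or it is \<open>insert y Q\<close> with path \<open>K\<close>,
  \<open>x\<close>, \<open>t2\<close>, \<open>t1\<close>.\<close>

lemma hole_cross:
  assumes gf: gemfree and h: "hole x (s @ y # t)" and s: "s \<noteq> []" and lt: "2 \<le> length t"
    and W: "conn W" "set s \<union> set t \<subseteq> W" "x \<notin> W" "y \<notin> W"
    and K: "conn K" "nbr x K" "nbr y K" "K \<inter> W = {}" "x \<notin> K" "y \<notin> K" "\<not> touch K W"
  shows False
proof -
  obtain t1 t2 where t: "t = t1 @ t2" "t1 \<noteq> []" "t2 \<noteq> []"
    using lt by (cases t; cases "tl t") (auto intro!: that[of "[hd t]" "tl t"])
  have ip: "ipath s" "ipath (y # t1 @ t2)" "ipath (t1 @ t2)" "ipath t1" "ipath t2"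
    using h by (auto simp: hole_def t ipath_append)
  have ys: "adj y (last s)" and yt: "adj y (hd t1)" and yV: "y \<in> V" "x \<in> V"
    using h s t by (auto simp: hole_def ipath_append adj_commute)
  have yt2: "\<not> nbr y (set t2)" using ip(2) t by (cases t1) (auto simp: nbr_def ipath_append)
  have xs: "adj x (hd s)" and xt: "adj x (last t2)"
    using h s t by (auto simp: hole_def)
  have dj: "set s \<inter> set t = {}" "y \<notin> set s" "y \<notin> set t" "set t1 \<inter> set t2 = {}" "x \<notin> set t" "x \<noteq> y"
    using h t by (auto simp: hole_def ipath_append)
  have xt1: "\<not> nbr x (set t1)"
  proof
    assume "nbr x (set t1)"
    then obtain z where z: "z \<in> set t1" "adj x z" by (auto simp: nbr_def)
    then have "z = hd (s @ y # t) \<or> z = last (s @ y # t)" using h t by (auto simp: hole_def)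
    then have "z \<in> set s \<or> z \<in> set t2" using s t by auto
    then show False using dj z t by auto
  qed
  have nxy: "\<not> adj x y"
  proof
    assume "adj x y"
    then have "y = hd (s @ y # t) \<or> y = last (s @ y # t)" using h by (auto simp: hole_def)
    then have "y \<in> set s \<or> y \<in> set t2" using s t by auto
    then show False using dj t by auto
  qed
  have hs: "hd s \<in> W - set t" using s W dj hd_in_set[of s] by blast
  obtain Q where Q: "is_comp (W - set t) Q" "hd s \<in> Q"
    using ex_comp[OF hs] connD(2)[OF W(1)] by blast
  note Qd = is_compD[OF Q(1)]
  have sQ: "set s \<subseteq> Q"
    using comp_absorb[OF Q(1) ipath_conn[OF ip(1) s]] Q(2) s W dj hd_in_set[of s] by blast
  have "W \<inter> set t = set t" "set t = set t1 \<union> set t2" "set t \<noteq> {}" using W(2) t by auto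
  then have Wt: "W \<inter> set t = set t1 \<union> set t2" "W \<inter> set t \<noteq> {}" by simp_all
  then have Qt: "touch Q (set t1) \<or> touch Q (set t2)"
    using comp_touch[OF W(1) Q(1) Wt(2)] by simp
  have xQ: "nbr x Q" using xs Q(2) by (auto simp: nbr_def)
  have yQ: "nbr y Q" using ys sQ last_in_set[OF s] unfolding nbr_def by blast
  have t12: "touch (set t1) (set t2)" using ipath_app_touch ip t by blast
  have yt': "nbr y (set t1)" using yt t by (auto simp: nbr_def)
  have xt': "nbr x (set t2)" using xt t by (auto simp: nbr_def)
  have ct: "conn (set t1)" "conn (set t2)" using ipath_conn ip t by blast+
  have Kt: "\<not> touch K (set t1)" "\<not> touch K (set t2)"
    using ntouch_sub[OF K(7), of K "set t1"] ntouch_sub[OF K(7), of K "set t2"] W(2) t by auto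
  have djQ: "Q \<inter> set t1 = {}" "Q \<inter> set t2 = {}" "Q \<subseteq> W" "x \<notin> Q" "y \<notin> Q" "Q \<inter> K = {}"
    using Qd t K W by auto
  have djK: "K \<inter> set t1 = {}" "K \<inter> set t2 = {}" using K W t by auto
  from Qt show False
  proof
    assume q: "touch Q (set t1)"
    show False
      by (rule gem_False[OF gf, of "insert x Q" K "{y}" "set t1" "set t2"])
        (use q conn_insert[OF Qd(2) xQ] K ct yV xQ yQ t12 yt' xt' yt2 Kt djQ djK dj t in
          \<open>auto simp: touch_commute\<close>)
  next
    assume q: "touch Q (set t2)"
    show False
      by (rule gem_False[OF gf, of "insert y Q" K "{x}" "set t2" "set t1"])
        (use q conn_insert[OF Qd(2) yQ] K ct yV xQ yQ t12 yt' xt' xt1 Kt djQ djK dj t in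
          \<open>auto simp: touch_commute\<close>)
  qed
qed

lemma hole_ends:
  assumes "hole b xs"
  shows "hd xs \<in> set xs" "last xs \<in> set xs" "hd xs \<noteq> last xs" "hd xs \<noteq> b" "last xs \<noteq> b"
    "adj b (hd xs)" "adj b (last xs)" "\<not> adj (hd xs) (last xs)" "xs \<noteq> []"
proof -
  have l: "4 \<le> length xs" using assms by (simp add: hole_def)
  then obtain p q r ys where xs: "xs = p # q # r # ys" "ys \<noteq> []"
    by (cases xs; cases "tl xs"; cases "tl (tl xs)"; cases "tl (tl (tl xs))") auto
  then have m: "last ys \<in> set ys" by simp
  then show "hd xs \<in> set xs" "last xs \<in> set xs" "hd xs \<noteq> last xs" "hd xs \<noteq> b" "last xs \<noteq> b"
    "adj b (hd xs)" "adj b (last xs)" "\<not> adj (hd xs) (last xs)" "xs \<noteq> []"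
    using assms xs unfolding hole_def by (auto simp: xs)
qed

text \<open>\<open>fan\<close> allows at most three attachments and 2-connectivity demands at least
  two. Exactly two lead to a thick cut or to \<open>hole_cross\<close>; three must be consecutive
  because of \<open>iso\<close>.\<close>

lemma hole_comp:
  assumes gf: gemfree and tc: two_connected and np: "\<And>a c. \<not> thick_cut a c"
    and h: "hole b xs" and K: "is_comp (V - insert b (set xs)) K"
  shows "\<exists>y ys. hole y ys \<and> insert y (set ys) = insert b (set xs) \<and>
    {z \<in> insert b (set xs). nbr z K} = {y, hd ys, last ys}"
proof -
  define Z where "Z = insert b (set xs)"
  define N where "N = {z \<in> Z. nbr z K}"
  have KZ: "is_comp (V - Z) K" using K by (simp add: Z_def)
  note Kd = is_compD[OF KZ]
  have finZ: "finite Z" and finN: "finite N" by (auto simp: Z_def N_def)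
  have NZ: "N \<subseteq> Z" by (auto simp: N_def)
  have ZV: "Z \<subseteq> V" using h ipath_V by (auto simp: Z_def hole_def)
  have cZ: "5 \<le> card Z"
    using h distinct_card[OF ipath_distinct, of xs] by (auto simp: Z_def hole_def)
  have rotate: "\<exists>ys. hole y ys \<and> insert y (set ys) = Z" if "y \<in> Z" for y
    using hole_rotate_to[OF h, of y] that by (auto simp: Z_def)
  have hZ: "y \<in> Z" "hd ys \<in> Z" "last ys \<in> Z" "set ys = Z - {y}"
    if "hole y ys" "insert y (set ys) = Z" for y ys
    using that hole_ends[OF that(1)] by (auto simp: hole_def)
  have nbrs: "adj y z \<longleftrightarrow> z = hd ys \<or> z = last ys"
    if "hole y ys" "insert y (set ys) = Z" "z \<in> Z" for y ys z
    using that hole_ends[OF that(1)] by (auto simp: hole_def)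
  have out: "z \<in> N" if "k \<in> K" "adj k z" "z \<notin> K" for k z
  proof -
    have "z \<in> Z" using that Kd(3) adj_in_V[OF that(2)] by (auto simp: touch_iff)
    then show ?thesis using that adj_commute by (auto simp: N_def nbr_def)
  qed
  have fan3: "card (N - {y}) \<le> 3" if yZ: "y \<in> Z" for y
  proof (rule ccontr)
    assume c: "\<not> ?thesis"
    obtain ys where ys: "hole y ys" "insert y (set ys) = Z" using rotate yZ by blast
    have "{x \<in> set ys. nbr x K} = N - {y}" using hZ(4)[OF ys] by (auto simp: N_def)
    moreover have "K \<inter> set ys = {}" using Kd(1) ys(2) by auto
    ultimately show False
      using fan[OF gf, of ys K] c ys(1) Kd(2) by (auto simp: hole_def)
  qed
  \<comment> \<open>Omitting an unattached hole vertex loses nothing in \<open>fan3\<close>. If all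
    are attached, the length of at least five already contradicts \<open>fan3\<close>.\<close>
  have N3: "card N \<le> 3"
  proof (cases "N = Z")
    case True
    moreover have "b \<in> Z" by (simp add: Z_def)
    ultimately show ?thesis using fan3[of b] cZ card_Diff_singleton[of b Z] by simp
  next
    case False
    then obtain y where "y \<in> Z" "y \<notin> N" using NZ by blast
    then show ?thesis using fan3[of y] by simp
  qed
  \<comment> \<open>An attachment \<open>y\<close> with no attached hole neighbour is merged into
    \<open>K\<close>. The enlarged set sees both hole neighbours of \<open>y\<close> and the two
    other attachments, four vertices of the path \<open>ys\<close>, against
    \<open>fan\<close>.\<close>
  have iso: "\<exists>z\<in>N. adj y z" if y: "y \<in> N" and c3: "card N = 3" for y
  proof (rule ccontr)
    assume no: "\<not> ?thesis"
    obtain ys where ys: "hole y ys" "insert y (set ys) = Z" using rotate y NZ by blast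
    note e = hole_ends[OF ys(1)]
    let ?A = "{hd ys, last ys} \<union> (N - {y})"
    have "hd ys \<notin> N" "last ys \<notin> N" using no e by auto
    then have "card ?A = 4" using e(3) c3 y finN by (subst card_Un_disjoint) auto
    moreover have "?A \<subseteq> {x \<in> set ys. nbr x (insert y K)}"
      using e hZ(4)[OF ys] NZ adj_commute by (auto simp: N_def)
    ultimately have "4 \<le> card {x \<in> set ys. nbr x (insert y K)}"
      by (metis (no_types, lifting) List.finite_set card_mono finite_Collect_conjI mem_Collect_eq
        rev_finite_subset subsetI)
    moreover have "conn (insert y K)" using conn_insert Kd(2) y by (auto simp: N_def)
    moreover have "insert y K \<inter> set ys = {}" using Kd(1) ys hZ(4)[OF ys] by auto
    ultimately show False using fan[OF gf, of ys "insert y K"] ys(1) by (auto simp: hole_def)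
  qed
  have "N \<noteq> {}"
  proof
    assume "N = {}"
    have "touch K (V - K)"
      using tc conn_touch[of V K] Kd ZV by (auto simp: two_connected_def Z_def)
    then show False using out \<open>N = {}\<close> by (auto simp: touch_iff)
  qed
  then obtain x where x: "x \<in> N" by blast
  obtain y where y: "y \<in> N" "y \<noteq> x"
  proof -
    have "\<not> Z \<subseteq> {x}" using cZ card_mono[of "{x}" Z] by auto
    then have "V - {x} - K \<noteq> {}" using Kd(1) ZV by blast
    moreover have "K \<subseteq> V - {x}" using Kd NZ x by auto
    ultimately have "touch K (V - {x} - K)" using two_connected_touch[OF tc] Kd(4) by blast
    then show ?thesis using that out by (auto simp: touch_iff)
  qed
  obtain ys where ys: "hole x ys" "insert x (set ys) = Z" using rotate x NZ by blast
  have "card N = 3 \<or> N = {x, y}"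
  proof (rule disjCI)
    assume "N \<noteq> {x, y}"
    then have "{x, y} \<subset> N" using x y by auto
    then have "card {x, y} < card N" using finN psubset_card_mono by blast
    then show "card N = 3" using N3 y by simp
  qed
  then have "\<exists>y ys. hole y ys \<and> insert y (set ys) = Z \<and> N = {y, hd ys, last ys}"
  proof
    assume c3: "card N = 3"
    obtain q where q: "q \<in> N" "adj x q" using iso x c3 by blast
    have "q \<noteq> x" using q by auto
    then have "card (N - {x, q}) = 1" using c3 x q finN by (simp add: card_Diff_insert)
    then obtain r where r: "N - {x, q} = {r}" using card_1_singletonE by blast
    then have N: "N = {x, q, r}" "r \<noteq> x" "r \<noteq> q" using x q by auto
    have fin: ?thesis if "m \<in> Z" "p1 \<in> Z" "p2 \<in> Z" "p1 \<noteq> p2" "adj m p1" "adj m p2" "N = {m, p1, p2}" for m p1 p2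
    proof -
      obtain ms where ms: "hole m ms" "insert m (set ms) = Z" using rotate \<open>m \<in> Z\<close> by blast
      have "{p1, p2} = {hd ms, last ms}" using nbrs[OF ms] that by blast
      then show ?thesis using ms that(7) by blast
    qed
    have "\<exists>z\<in>N. adj r z" using iso c3 N by blast
    then have "adj r x \<or> adj r q" using N by auto
    then show ?thesis
    proof
      assume "adj r x"
      then show ?thesis using fin[of x q r] N NZ q adj_commute by auto
    next
      assume "adj r q"
      then show ?thesis using fin[of q x r] N NZ q adj_commute by auto
    qed
  next
    assume N: "N = {x, y}"
    have xy: "x \<in> V" "y \<in> V" "x \<in> Z" "y \<in> Z" using x y NZ ZV by auto
    have Kout: "\<not> touch K (V - {x, y} - K)" using out N by (auto simp: touch_iff)
    have KV: "K \<subseteq> V - {x, y}" using Kd xy by auto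
    have yys: "y \<in> set ys" using ys(2) xy y by auto
    have rest: "V - {x, y} - K \<noteq> {}"
    proof
      assume "V - {x, y} - K = {}"
      then have "Z \<subseteq> {x, y}" using Kd(1) ZV by auto
      then have "card Z \<le> card {x, y}" by (intro card_mono) auto
      then show False using cZ y by simp
    qed
    have nadj: "\<not> adj x y"
      using np[of x y] thick_cutI2[of x y K] Kd(4) KV rest Kout by blast
    obtain s t where st: "ys = s @ y # t" using yys split_list by metis
    have "y \<noteq> hd ys" "y \<noteq> last ys" using nbrs[OF ys, of y] nadj xy by auto
    then have ne: "s \<noteq> []" "t \<noteq> []" using st by auto
    have ip: "ipath s" "ipath t" "y \<notin> set s" "y \<notin> set t" "set s \<inter> set t = {}" "x \<notin> set s" "x \<notin> set t"
      using ys(1) st by (auto simp: hole_def ipath_append)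
    have stZ: "set s \<subseteq> Z" "set t \<subseteq> Z" using st ys(2) by auto
    have "hd s \<in> V - {x, y}" using ne ip stZ ZV hd_in_set[of s] by blast
    then obtain W where W: "is_comp (V - {x, y}) W" "hd s \<in> W"
      using ex_comp[of "hd s" "V - {x, y}"] by blast
    note Wd = is_compD[OF W(1)]
    have "K \<noteq> W" using W(2) ne stZ hd_in_set[of s] Kd(1) by blast
    have "is_comp (V - {x, y}) K" using KV Kd(2) Kout by (simp add: is_comp_def)
    then have KW: "\<not> touch K W" "K \<inter> W = {}" using comps_ntouch W(1) \<open>K \<noteq> W\<close> by blast+
    have sW: "set s \<subseteq> W"
      using comp_absorb[OF W(1) ipath_conn[OF ip(1) ne(1)]] W(2) ne ip stZ ZV hd_in_set[of s] by blast
    \<comment> \<open>If the arc \<open>t\<close> were outside \<open>W\<close>, then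
      \<open>K\<close>, \<open>W\<close> and the remainder would make \<open>x\<close>,
      \<open>y\<close> a thick cut.\<close>
    have tW: "set t \<subseteq> W"
    proof (rule ccontr)
      assume "\<not> set t \<subseteq> W"
      then have "W \<inter> set t = {}"
        using comp_absorb[OF W(1) ipath_conn[OF ip(2) ne(2)]] ip stZ ZV by blast
      then have "hd t \<in> V - {x, y} - K - W"
        using ne ip stZ ZV Kd(1) hd_in_set[of t] by blast
      then have "thick_cut x y"
        using xy y(2) Kd(4) Wd KW KV Kout by (intro thick_cutI3[of x y K W]) auto
      then show False using np by blast
    qed
    have xKy: "nbr x K" "nbr y K" using x y by (auto simp: N_def)
    have h1: "hole x (s @ y # t)" and h2: "hole x (rev t @ y # rev s)"
      using ys(1) st hole_rev[OF ys(1)] by auto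
    have Wxy: "x \<notin> W" "y \<notin> W" "x \<notin> K" "y \<notin> K" using Wd(1) KV by auto
    have len: "2 \<le> length t \<or> 2 \<le> length s" using h1 by (auto simp: hole_def)
    have False
      using len hole_cross[OF gf h1 ne(1) _ Wd(2) _ Wxy(1,2) Kd(2) xKy KW(2) Wxy(3,4) KW(1)]
        hole_cross[OF gf h2 _ _ Wd(2) _ Wxy(1,2) Kd(2) xKy KW(2) Wxy(3,4) KW(1)]
        sW tW ne by auto
    then show ?thesis ..
  qed
  then show ?thesis unfolding N_def Z_def by blast
qed

text \<open>In the application \<open>L\<close> is the arc of the hole opposite to \<open>b\<close>,
  and \<open>D\<close> the other side of the cut \<open>a\<close>, \<open>c\<close>. If
  \<open>u\<close> misses \<open>c\<close>, its component of \<open>D - {b}\<close> has a further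
  piece \<open>X\<close>, next to \<open>u\<close> and seen by \<open>c\<close>. If \<open>a\<close>
  sees \<open>X\<close>, the hub is \<open>{a, b}\<close>. Otherwise \<open>b\<close> lies in a
  component \<open>Q\<close> of the rest of \<open>D\<close> that reaches \<open>X\<close> or
  \<open>u\<close>, and the hub is \<open>Q\<close> with \<open>a\<close> or with \<open>c\<close>,
  respectively.\<close>

lemma hole_common_nbr:
  assumes gf: gemfree and L: "conn L" "\<not> touch L D" "nbr a L" "nbr c L" "L \<inter> D = {}"
    and ac: "a \<noteq> c" "\<not> adj a c" "a \<notin> L \<union> D" "c \<notin> L \<union> D"
    and D: "conn D" "b \<in> D" "adj b a" "adj b c"
    and comps: "\<And>W. is_comp (D - {b}) W \<Longrightarrow> nbr a W \<and> nbr c W"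
    and u: "u \<in> D" "adj u a"
  shows "adj u c"
proof (rule ccontr)
  assume uc: "\<not> adj u c"
  have V: "D \<subseteq> V" "a \<in> V" "c \<in> V" "b \<in> V" "u \<in> V" using connD D u adj_in_V by blast+
  have "u \<noteq> b" using uc D by auto
  then obtain W where W: "is_comp (D - {b}) W" "u \<in> W"
    using ex_comp[of u "D - {b}"] u V by blast
  note Wd = is_compD[OF W(1)]
  obtain v where v: "v \<in> W" "adj c v" using comps[OF W(1)] by (auto simp: nbr_def)
  have "v \<noteq> u" using v uc adj_commute by auto
  then obtain X where X: "is_comp (W - {u}) X" "v \<in> X"
    using ex_comp[of v "W - {u}"] v Wd by blast
  note Xd = is_compD[OF X(1)]
  have uX: "nbr u X" using comp_touch[OF Wd(2) X(1)] W(2) by auto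
  have cX: "nbr c X" using v X(2) by (auto simp: nbr_def)
  have sub: "X \<subseteq> D" "b \<notin> X" "u \<notin> X" "a \<notin> X" "c \<notin> X" "X \<inter> L = {}" using Xd Wd ac L by auto
  have nL: "\<not> nbr u L" "\<not> touch L X" "\<not> nbr u L"
    using ntouch_elem[OF L(2)] u ntouch_sub[OF L(2), of L X] sub by auto
  have dj: "a \<noteq> b" "c \<noteq> b" "a \<noteq> u" "c \<noteq> u" "b \<notin> L" "u \<notin> L" "a \<notin> L" "c \<notin> L"
    using ac L D u by auto
  show False
  proof (cases "nbr a X")
    case True
    have "conn {a, b}" using conn_insert[of "{b}" a] V D adj_commute by auto
    then show False
      using True uX cX sub nL dj V D u uc ac L Xd
      by (intro gem_False[OF gf, of "{a, b}" "{u}" X "{c}" L]) (auto simp: adj_commute touch_commute)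
  next
    case False
    obtain Q where Q: "is_comp (D - insert u X) Q" "b \<in> Q"
      using ex_comp[of b "D - insert u X"] D V sub \<open>u \<noteq> b\<close> by blast
    note Qd = is_compD[OF Q(1)]
    have "touch Q (D \<inter> insert u X)" using comp_touch[OF D(1) Q(1)] u by auto
    moreover have "D \<inter> insert u X = insert u X" using sub u by auto
    ultimately have t: "nbr u Q \<or> touch X Q" by (simp add: touch_commute)
    have aQ: "nbr a Q" "nbr c Q" using Q(2) D adj_commute by (auto simp: nbr_def)
    have djQ: "Q \<inter> X = {}" "u \<notin> Q" "a \<notin> Q" "c \<notin> Q" "Q \<inter> L = {}" using Qd ac L by auto
    from t show False
    proof
      assume "touch X Q"
      then show False
        using False aQ djQ uX cX sub nL dj V D u uc ac L Xd conn_insert[OF Qd(2) aQ(1)]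
        by (intro gem_False[OF gf, of "insert a Q" L "{c}" X "{u}"]) (auto simp: adj_commute touch_commute)
    next
      assume "nbr u Q"
      then show False
        using False aQ djQ uX cX sub nL dj V D u uc ac L Xd conn_insert[OF Qd(2) aQ(2)]
        by (intro gem_False[OF gf, of "insert c Q" L "{a}" "{u}" X]) (auto simp: adj_commute touch_commute)
    qed
  qed
qed

text \<open>The attachments of \<open>K\<close> and \<open>K'\<close> are centred at
  \<open>b\<close> and at \<open>y\<close>. The arc \<open>s\<close> joins \<open>K\<close> to
  \<open>K'\<close>, and the union is the hub of a gem with path \<open>b\<close>, \<open>t\<close>,
  \<open>z\<close>, \<open>y\<close>.\<close>

lemma hole_two_comps:
  assumes gf: gemfree and h: "hole b (s @ y # z # t)" and ne: "s \<noteq> []" "t \<noteq> []"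
    and K: "conn K" "nbr b K" "nbr (hd s) K" "nbr (last t) K"
    and K': "conn K'" "nbr (last s) K'" "nbr y K'" "nbr z K'"
    and dj: "(K \<union> K') \<inter> insert b (set (s @ y # z # t)) = {}"
  shows False
proof -
  have ip: "ipath s" "ipath t" using h by (auto simp: hole_def ipath_append)
  let ?H = "K \<union> (K' \<union> set s)"
  have c1: "conn (K' \<union> set s)"
    using conn_Un[OF K'(1) ipath_conn[OF ip(1) ne(1)]] touchI2[OF K'(2)] ne by simp
  have c2: "conn ?H"
    using conn_Un[OF K(1) c1] touchI2[OF K(3), of "set s"] ne by simp
  have V: "b \<in> V" "y \<in> V" "z \<in> V" using h by (auto simp: hole_def ipath_append)
  have a: "adj y z" "nbr z (set t)" "\<not> nbr y (set t)"
    using h ne hd_in_set[of t] by (auto simp: hole_def ipath_append nbr_def)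
  have lt: "last t \<in> set t" "hd s \<in> set s" using ne by auto
  have "hd (s @ y # z # t) = hd s" "last (s @ y # z # t) = last t" using ne by auto
  then have b: "adj b x \<longleftrightarrow> x = hd s \<or> x = last t" if "x \<in> insert y (insert z (set t))" for x
    using h that by (auto simp: hole_def)
  have d: "y \<noteq> z" "y \<notin> set s" "y \<notin> set t" "z \<notin> set s" "z \<notin> set t" "set s \<inter> set t = {}"
     "b \<notin> set s" "b \<notin> set t" "b \<noteq> y" "b \<noteq> z"
    using h by (auto simp: hole_def ipath_append)
  have bt: "nbr b (set t)" "\<not> adj b y" "\<not> adj b z" using b d lt by (auto simp: nbr_def)
  show False
    by (rule gem_False[OF gf, of ?H "{b}" "set t" "{z}" "{y}"])
      (use c2 V ip ne ipath_conn a bt d dj K K' touchI[OF K(4) lt(1)] in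
        \<open>auto simp: touch_commute adj_commute\<close>)
qed

lemma ipath_two_nbrs:
  assumes p: "ipath xs" and m: "y \<in> set xs" "p \<in> set xs" "q \<in> set xs" "p \<noteq> q" "adj y p" "adj y q"
  obtains s t where "xs = s @ y # t" "s \<noteq> []" "t \<noteq> []" "{p, q} = {last s, hd t}"
proof -
  obtain s t where st: "xs = s @ y # t" using m split_list by metis
  have 1: "z = last s" "s \<noteq> []" if "adj y z" "z \<in> set s" for z
    using p that adj_commute[of y z] st by (auto simp: ipath_append)
  have 2: "z = hd t" "t \<noteq> []" if "adj y z" "z \<in> set t" for z
    using p that st by (auto simp: ipath_append)
  have "p \<in> set s \<or> p \<in> set t" "q \<in> set s \<or> q \<in> set t" using m st by auto
  moreover have "\<not> (p \<in> set s \<and> q \<in> set s)" "\<not> (p \<in> set t \<and> q \<in> set t)"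
    using 1(1)[OF m(5)] 1(1)[OF m(6)] 2(1)[OF m(5)] 2(1)[OF m(6)] m(4) by auto
  ultimately have "p \<in> set s \<and> q \<in> set t \<or> p \<in> set t \<and> q \<in> set s" by blast
  then have "s \<noteq> [] \<and> t \<noteq> [] \<and> {p, q} = {last s, hd t}"
  proof (elim disjE conjE)
    assume "p \<in> set s" "q \<in> set t"
    then show ?thesis using 1[OF m(5)] 2[OF m(6)] by simp
  next
    assume "p \<in> set t" "q \<in> set s"
    then show ?thesis using 2[OF m(5)] 1[OF m(6)] by (simp add: insert_commute)
  qed
  then show ?thesis using that st by blast
qed

text \<open>If \<open>K'\<close> misses \<open>b\<close>, its three attachments lie on the path and
  \<open>hole_two_comps\<close> applies. If it sees \<open>b\<close> and also a vertex outside
  \<open>{b, c, a}\<close>, then its centre \<open>q\<close> is one of \<open>a\<close>,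
  \<open>c\<close> and it misses the other one, \<open>p\<close>; the hub \<open>b\<close> with path
  \<open>p\<close>, \<open>K\<close>, \<open>q\<close>, \<open>K'\<close> is a gem.\<close>

lemma hole_centre:
  assumes gf: gemfree and tc: two_connected and np: "\<And>a c. \<not> thick_cut a c"
    and h: "hole b (c # L @ [a])"
    and K: "is_comp (V - insert b (set (c # L @ [a]))) K"
    and KN: "{z \<in> insert b (set (c # L @ [a])). nbr z K} = {b, c, a}"
    and K': "is_comp (V - insert b (set (c # L @ [a]))) K'"
  shows "{z \<in> insert b (set (c # L @ [a])). nbr z K'} = {b, c, a}"
proof (cases "K' = K")
  case True
  then show ?thesis using KN by simp
next
  case False
  define xs where "xs = c # L @ [a]"
  define Z where "Z = insert b (set xs)"
  note defs = xs_def[symmetric] Z_def[symmetric]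
  have h: "hole b xs" and K: "is_comp (V - Z) K" and K': "is_comp (V - Z) K'"
    and KN: "{z \<in> Z. nbr z K} = {b, c, a}" using assms(4-7) unfolding xs_def Z_def by blast+
  note Kd = is_compD[OF K] and K'd = is_compD[OF K']
  have KK: "\<not> touch K K'" "K \<inter> K' = {}" using comps_ntouch[OF K K'] False by auto
  have ends: "hd xs = c" "last xs = a" by (auto simp: xs_def)
  note e = hole_ends[OF h, unfolded ends]
  obtain y ys where y: "hole y ys" "insert y (set ys) = Z" "{z \<in> Z. nbr z K'} = {y, hd ys, last ys}"
    using hole_comp[OF gf tc np h K'[unfolded Z_def]] unfolding Z_def by blast
  note ye = hole_ends[OF y(1)]
  have N': "nbr z K' \<longleftrightarrow> z = y \<or> z = hd ys \<or> z = last ys" if "z \<in> Z" for z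
    using y(3) that by blast
  have N: "nbr z K \<longleftrightarrow> z = b \<or> z = c \<or> z = a" if "z \<in> Z" for z
    using KN that by blast
  have yZ: "y \<in> Z" "hd ys \<in> Z" "last ys \<in> Z" using y(2) ye by auto
  have bZ: "b \<in> Z" "a \<in> Z" "c \<in> Z" "set xs \<subseteq> Z" using e by (auto simp: Z_def)
  have ZV: "Z \<subseteq> V" using h ipath_V by (auto simp: Z_def hole_def)
  have badj: "adj b z \<longleftrightarrow> z = c \<or> z = a" if "z \<in> Z" for z
    using h that ends e(4,5) by (auto simp: Z_def hole_def)
  show ?thesis
  proof (cases "nbr b K'")
    case False
    then have b: "b \<noteq> y" "b \<noteq> hd ys" "b \<noteq> last ys" using N' bZ by auto
    then have in_xs: "y \<in> set xs" "hd ys \<in> set xs" "last ys \<in> set xs" using yZ by (auto simp: Z_def)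
    have ip: "ipath xs" using h by (simp add: hole_def)
    obtain s t where st: "xs = s @ y # t" "s \<noteq> []" "t \<noteq> []" "{hd ys, last ys} = {last s, hd t}"
      using ipath_two_nbrs[OF ip in_xs ye(3,6,7)] by blast
    have nb: "nbr (last s) K'" "nbr (hd t) K'" "nbr y K'" 
    proof -
      have "last s \<in> {hd ys, last ys}" "hd t \<in> {hd ys, last ys}" by (simp_all add: st(4))
      then show "nbr (last s) K'" "nbr (hd t) K'" "nbr y K'" using N' yZ by auto
    qed
    have nK: "nbr b K" "nbr (hd s) K" "nbr (last t) K"
      using N bZ ends st by auto
    have dj: "(K \<union> K') \<inter> insert b (set xs) = {}" using Kd K'd by (auto simp: Z_def)
    have False
    \<comment> \<open>\<open>hole_two_comps\<close> needs a vertex beyond \<open>hd t\<close>. If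
      there is none, then \<open>s\<close> has at least two vertices, because \<open>xs\<close> has
      at least four, and the reversed hole works.\<close>
    proof (cases "tl t = []")
      case False
      then have "t = hd t # tl t" "last (tl t) = last t" using st(3) by (auto simp: last_tl)
      then show False
        using hole_two_comps[OF gf, of b s y "hd t" "tl t" K K'] h st dj nb nK Kd K'd False by auto
    next
      case True
      then have t: "length t = 1" using st(3) by (cases t) auto
      have l: "4 \<le> length xs" using h by (simp add: hole_def)
      obtain s0 w where s: "s = s0 @ [w]" using st(2) rev_exhaust by blast
      have "s0 \<noteq> []" using l t st(1) s by auto
      have "hole b (rev t @ y # w # rev s0)" using hole_rev[OF h] st(1) s by simp
      moreover have "set (rev t @ y # w # rev s0) = set xs" using st(1) s by auto
      ultimately show False
        using st(2,3) dj nb nK Kd(2) K'd(2) s \<open>s0 \<noteq> []\<close>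
        by (intro hole_two_comps[OF gf, of b "rev t" y w "rev s0" K K']) (simp_all add: hd_rev last_rev)
    qed
    then show ?thesis ..
  next
    case True
    have "{z \<in> Z. nbr z K'} \<subseteq> {b, c, a}"
    proof (rule ccontr)
      assume "\<not> ?thesis"
      then obtain l where l: "l \<in> Z" "nbr l K'" "l \<noteq> b" "l \<noteq> c" "l \<noteq> a" by blast
      have nbl: "\<not> adj b l" using badj l by blast
      have "b \<noteq> y" "l \<noteq> y" using nbl l N' bZ True ye(6,7) adj_commute by metis+
      then have bl: "{b, l} = {hd ys, last ys}" using l N' bZ True by blast
      then have "b \<in> {hd ys, last ys}" by blast
      then have "adj y b" using ye(6,7) by auto
      then have "adj b y" using adj_commute[of y b] by blast
      then have yac: "y = a \<or> y = c" using badj yZ by blast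
      have gem: False if "{p, q} = {a, c}" "nbr q K'" "\<not> nbr p K'" for p q
      proof -
        have pq: "p \<in> Z" "q \<in> Z" "p \<noteq> q" "\<not> adj p q" "adj b p" "adj b q" "p \<noteq> b" "q \<noteq> b"
          "nbr p K" "nbr q K"
          using that e bZ N adj_commute by (auto simp: doubleton_eq_iff)
        show False
          by (rule gem_False[OF gf, of "{b}" "{p}" K "{q}" K'])
            (use that pq Kd K'd KK True N bZ ZV in \<open>auto simp: adj_commute touch_commute\<close>)
      qed
      show False
        using yac
      proof
        assume "y = a"
        moreover have "\<not> nbr c K'"
        proof -
          have "c \<notin> {hd ys, last ys}" using bl[symmetric] e l by simp
          then show ?thesis using N' bZ e \<open>y = a\<close> by auto
        qed
        ultimately show False using gem[of c a] N' yZ by blast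
      next
        assume "y = c"
        moreover have "\<not> nbr a K'"
        proof -
          have "a \<notin> {hd ys, last ys}" using bl[symmetric] e l by simp
          then show ?thesis using N' bZ e \<open>y = c\<close> by auto
        qed
        ultimately show False using gem[of a c] N' yZ by blast
      qed
    qed
    moreover have "card {z \<in> Z. nbr z K'} = 3" using y(3) ye by (simp add: hole_def)
    moreover have "card {b, c, a} = 3" using e by simp
    ultimately have "{z \<in> Z. nbr z K'} = {b, c, a}" by (metis card_subset_eq finite.emptyI finite.insertI)
    then show ?thesis unfolding Z_def xs_def .
  qed
qed

text \<open>The pair \<open>a\<close>, \<open>c\<close> is not thick, so \<open>cut_good\<close>
  does not apply to it. The side \<open>set L\<close> is a path because it is an arc of the hole;
  the side \<open>D\<close> is settled by \<open>hole_common_nbr\<close> followed by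
  \<open>complete_comp\<close>.\<close>

lemma hole_good:
  assumes gf: gemfree and tc: two_connected and np: "\<And>a c. \<not> thick_cut a c"
    and h0: "hole b0 xs0"
  shows "\<exists>X\<subseteq>V. card X \<le> 2 \<and> (\<forall>D. is_comp (V - X) D \<longrightarrow> good D)"
proof (cases "V \<subseteq> insert b0 (set xs0)")
  case True
  \<comment> \<open>The graph is just a cycle, and deleting one vertex leaves a path.\<close>
  have ip: "ipath xs0" "b0 \<in> V" "b0 \<notin> set xs0" using h0 by (auto simp: hole_def)
  note e = hole_ends[OF h0]
  have V: "V - {b0} = set xs0" using True ip ipath_V by auto
  have "good D" if "is_comp (V - {b0}) D" for D
  proof -
    have "D = set xs0"
      using comp_absorb[OF that ipath_conn[OF ip(1) e(9)]] is_compD[OF that] V by auto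
    moreover have "card {y. adj x y} = 2" if x: "x \<in> set (butlast (tl xs0))" for x
    proof (rule ipath_inner_degree[OF ip(1) x])
      fix y assume y: "adj x y"
      note i = inner_not_ends[OF ipath_distinct[OF ip(1)] x]
      have "\<not> adj b0 x" using i h0 by (auto simp: hole_def)
      then have "y \<noteq> b0" using y adj_commute by blast
      then show "y \<in> set xs0" using V adj_in_V[OF y] by blast
    qed
    ultimately show ?thesis using ip e(9) by (auto simp: good_def)
  qed
  then show ?thesis using ip by (intro exI[of _ "{b0}"]) auto
next
  case False
  then obtain k where "k \<in> V - insert b0 (set xs0)" by blast
  then obtain K where K0: "is_comp (V - insert b0 (set xs0)) K"
    using ex_comp[of k "V - insert b0 (set xs0)"] by blast
  obtain b xs where h: "hole b xs" and Z: "insert b (set xs) = insert b0 (set xs0)"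
    and KN0: "{z \<in> insert b (set xs). nbr z K} = {b, hd xs, last xs}"
    using hole_comp[OF gf tc np h0 K0] by auto
  define Z where "Z = insert b (set xs)"
  obtain c L a where xs: "xs = c # L @ [a]" "2 \<le> length L"
  proof -
    have "4 \<le> length xs" using h by (simp add: hole_def)
    then have "xs = hd xs # butlast (tl xs) @ [last xs]" "2 \<le> length (butlast (tl xs))"
      by (cases xs; cases "tl xs"; auto)+
    then show ?thesis using that by blast
  qed
  note e = hole_ends[OF h]
  have Lne: "L \<noteq> []" using xs by auto
  have K: "is_comp (V - Z) K" using K0 Z by (simp add: Z_def)
  have comps: "{z \<in> Z. nbr z W} = {b, c, a}" if "is_comp (V - Z) W" for W
    using hole_centre[OF gf tc np h[unfolded xs(1)], of K W] K KN0 that by (simp add: Z_def xs(1))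
  have cN: "nbr z W \<longleftrightarrow> z \<in> {b, c, a}" if "is_comp (V - Z) W" "z \<in> Z" for z W
    using comps[OF that(1)] that(2) by blast
  have ZV: "Z \<subseteq> V" using h ipath_V by (auto simp: Z_def hole_def)
  have ip: "ipath (c # L @ [a])" "ipath L" using h xs by (auto simp: hole_def ipath_append)
  have V: "a \<in> V" "c \<in> V" "b \<in> V" "set L \<subseteq> V" using ZV xs by (auto simp: Z_def)
  have ne: "a \<noteq> c" "a \<noteq> b" "c \<noteq> b" "a \<notin> set L" "c \<notin> set L" "b \<notin> set L"
    using ipath_distinct[OF ip(1)] h unfolding hole_def xs(1) by auto
  have nac: "\<not> adj a c" using e(8) xs adj_commute by auto
  have bac: "adj b a" "adj b c" using e xs by auto
  have bL: "\<not> nbr b (set L)" using h ip ne by (auto simp: hole_def xs nbr_def)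
  have aL: "z \<in> set L \<Longrightarrow> adj z a \<longleftrightarrow> z = last L" and cL: "z \<in> set L \<Longrightarrow> adj z c \<longleftrightarrow> z = hd L" for z
    using ip Lne adj_commute[of z c] by (auto simp: ipath_append)
  have nL: "nbr a (set L)" "nbr c (set L)"
    using aL[of "last L"] cL[of "hd L"] Lne adj_commute by (auto simp: nbr_def)
  \<comment> \<open>Every component outside the hole is attached to \<open>b\<close>,
    \<open>c\<close>, \<open>a\<close> only, so the vertices of \<open>L\<close> have no neighbour
    off the hole.\<close>
  have Lout: "y \<in> set L \<or> y = a \<or> y = c" if "l \<in> set L" "adj l y" for l y
  proof (rule ccontr)
    assume n: "\<not> ?thesis"
    have "y \<noteq> b" using bL that adj_commute by (auto simp: nbr_def)
    then have "y \<in> V - Z" using n adj_in_V[OF that(2)] by (auto simp: Z_def xs)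
    then obtain W where W: "is_comp (V - Z) W" "y \<in> W" using ex_comp[of y "V - Z"] by blast
    then have "nbr l W" using that by (auto simp: nbr_def)
    then show False using cN[OF W(1), of l] that ne by (auto simp: Z_def xs)
  qed
  define D where "D = V - {a, c} - set L"
  have LDn: "\<not> touch (set L) D"
    using Lout by (auto simp: touch_iff D_def)
  have bD: "b \<in> D" using V ne by (auto simp: D_def)
  have DZ: "D - {b} = V - Z" by (auto simp: D_def Z_def xs)
  \<comment> \<open>All components outside the hole hang on \<open>b\<close>.\<close>
  have conD: "conn D"
  proof -
    let ?F = "{C. conn C \<and> b \<in> C \<and> C \<subseteq> D}"
    have "x \<in> \<Union>?F" if x: "x \<in> D" for x
    proof (cases "x = b")
      case True
      then have "{b} \<in> ?F" using bD V by auto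
      then show ?thesis using True by blast
    next
      case False
      then have "x \<in> V - Z" using x DZ by blast
      then obtain W where W: "is_comp (V - Z) W" "x \<in> W" using ex_comp[of x "V - Z"] by blast
      have "conn (insert b W)"
        using conn_insert is_compD(2)[OF W(1)] cN[OF W(1), of b] by (auto simp: Z_def)
      moreover have "insert b W \<subseteq> D" using is_compD(1)[OF W(1)] bD DZ by blast
      ultimately have "insert b W \<in> ?F" by blast
      then show ?thesis using W(2) by blast
    qed
    then have "D = \<Union>?F" by blast
    moreover have "conn (\<Union>?F)" using bD V by (intro conn_Union[of _ b]) auto
    ultimately show ?thesis by simp
  qed
  have conL: "conn (set L)" using ipath_conn ip Lne by blast
  have compL: "is_comp (V - {a, c}) (set L)"
    using conL V ne LDn ntouch_sub[OF LDn] by (auto simp: is_comp_def D_def)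
  have compD: "is_comp (V - {a, c}) D"
  proof -
    have "V - {a, c} - D \<subseteq> set L" by (auto simp: D_def)
    then have "\<not> touch (V - {a, c} - D) D" using ntouch_sub[OF LDn] by blast
    then show ?thesis using conD touch_commute by (auto simp: is_comp_def D_def)
  qed
  have goodL: "good (set L)"
  proof -
    have "card {y. adj x y} = 2" if x: "x \<in> set (butlast (tl L))" for x
    proof (rule ipath_inner_degree[OF ip(2) x])
      fix y assume y: "adj x y"
      note i = inner_not_ends[OF ipath_distinct[OF ip(2)] x]
      then have "y \<noteq> a" "y \<noteq> c" using aL cL y by auto
      then show "y \<in> set L" using Lout i y by blast
    qed
    then show ?thesis using ip Lne by (auto simp: good_def)
  qed
  have Wnbr: "nbr a W" "nbr c W" if "is_comp (D - {b}) W" for W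
    using that cN[of W a] cN[of W c] unfolding DZ by (auto simp: Z_def xs)
  have dj: "set L \<inter> D = {}" "a \<notin> set L \<union> D" "c \<notin> set L \<union> D" using ne by (auto simp: D_def)
  have eq: "adj x a \<longleftrightarrow> adj x c" if "x \<in> D" for x
  proof
    show "adj x a \<Longrightarrow> adj x c"
      using hole_common_nbr[OF gf conL LDn nL dj(1) ne(1) nac dj(2,3) conD bD bac] Wnbr that by blast
    show "adj x c \<Longrightarrow> adj x a"
      using hole_common_nbr[OF gf conL LDn nL(2,1) dj(1) ne(1)[symmetric] _ dj(3,2) conD bD bac(2,1)]
        Wnbr that nac adj_commute by blast
  qed
  have outD: "\<not> touch D (V - ({a} \<union> {c} \<union> D))"
    using is_compD(3)[OF compD] by (elim ntouch_sub) auto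
  have all: "nbr x {a}" if "x \<in> D" for x
    by (rule complete_comp[OF gf tc, of "{a}" "{c}" "set L" D])
      (use V conL conD ne dj nL outD eq that touchI[OF _ bD, of "{a}"] bac in \<open>auto simp: touch_commute\<close>)
  have goodD: "good D"
    using dominated_p4free[OF gf, of "{a}" D] V dj all by (auto simp: good_def)
  have "good W" if W: "is_comp (V - {a, c}) W" for W
  proof -
    have "W = set L \<or> W = D"
    proof (rule ccontr)
      assume "\<not> ?thesis"
      then have "W \<inter> set L = {}" "W \<inter> D = {}"
        using comp_disj[OF W compL] comp_disj[OF W compD] by auto
      then show False using is_compD[OF W] by (auto simp: D_def)
    qed
    then show ?thesis using goodL goodD by blast
  qed
  moreover have "card {a, c} \<le> 2" using ne by simp
  ultimately show ?thesis using V by (intro exI[of _ "{a, c}"]) auto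
qed

section \<open>Graphs without long holes\<close>

lemma P4_rev: "P4 p q r s \<Longrightarrow> P4 s r q p"
  unfolding P4_def by (simp add: adj_commute)

text \<open>A shortest path through \<open>K\<close> between neighbours of \<open>p1\<close> and
  \<open>p4\<close> closes the \<open>P4\<close> to an induced cycle with at least five
  vertices.\<close>

lemma P4_closing_hole:
  assumes P: "P4 p1 p2 p3 p4" and K: "conn K" "nbr p1 K" "nbr p4 K" "\<not> nbr p2 K" "\<not> nbr p3 K"
    and dj: "{p1, p2, p3, p4} \<inter> K = {}"
  shows "\<exists>b xs. hole b xs"
proof -
  have "{x. adj p1 x} \<inter> K \<noteq> {}" "{x. adj p4 x} \<inter> K \<noteq> {}"
    using K(2,3) by (auto simp: nbr_def)
  from shortest_path[OF K(1) this] obtain xs where xs: "ipath xs" "xs \<noteq> []" "set xs \<subseteq> K"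
    "\<And>x. x \<in> set xs \<Longrightarrow> adj p1 x \<longleftrightarrow> x = hd xs" "\<And>x. x \<in> set xs \<Longrightarrow> adj p4 x \<longleftrightarrow> x = last xs"
    by auto
  have n: "\<not> adj p2 x" "\<not> adj p3 x" "x \<noteq> p1" "x \<noteq> p2" "x \<noteq> p3" "x \<noteq> p4" if "x \<in> set xs" for x
    using that xs(3) K(4,5) dj by (auto simp: nbr_def)
  have ni: "p1 \<notin> set xs" "p2 \<notin> set xs" "p3 \<notin> set xs" "p4 \<notin> set xs"
    "hd xs \<in> set xs" "last xs \<in> set xs" using xs(2,3) dj by auto
  have m: "x \<in> set xs \<Longrightarrow> adj x p1 \<longleftrightarrow> x = hd xs" for x using xs(4) adj_commute by metis
  have q: "ipath (rev xs @ [p1])"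
    using xs(1,2) m n ni P4_V[OF P] by (auto simp: ipath_append ipath_rev last_rev)
  have r: "ipath (p4 # rev xs @ [p1])"
    using q xs n ni P4_V[OF P] P4_distinct[OF P] P
    by (auto simp: hd_append hd_rev P4_def adj_commute)
  have s: "ipath (p3 # p4 # rev xs @ [p1])"
    using r n ni P4_V[OF P] P4_distinct[OF P] P by (auto simp: P4_def adj_commute)
  have "4 \<le> length (p3 # p4 # rev xs @ [p1])" using xs(2) by (cases xs) auto
  then have "hole p2 (p3 # p4 # rev xs @ [p1])"
    using s n ni P4_V[OF P] P4_distinct[OF P] P unfolding hole_def by (auto simp: P4_def adj_commute)
  then show ?thesis by blast
qed

text \<open>A shortest path in \<open>K\<close> between neighbours of \<open>p2\<close> and
  \<open>p4\<close> forms an induced cycle with \<open>p2\<close>, \<open>p3\<close>,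
  \<open>p4\<close>. Without long holes that path is a single vertex.\<close>

lemma P4_common_nbr:
  assumes nh: "\<And>b xs. \<not> hole b xs"
    and P: "P4 p1 p2 p3 p4" and K: "conn K" "nbr p2 K" "nbr p4 K" "\<not> nbr p3 K"
    and dj: "{p1, p2, p3, p4} \<inter> K = {}"
  obtains d where "d \<in> K" "adj p2 d" "adj p4 d"
proof -
  have "{x. adj p2 x} \<inter> K \<noteq> {}" "{x. adj p4 x} \<inter> K \<noteq> {}"
    using K(2,3) by (auto simp: nbr_def)
  from shortest_path[OF K(1) this] obtain xs where xs: "ipath xs" "xs \<noteq> []" "set xs \<subseteq> K"
    "\<And>x. x \<in> set xs \<Longrightarrow> adj p2 x \<longleftrightarrow> x = hd xs" "\<And>x. x \<in> set xs \<Longrightarrow> adj p4 x \<longleftrightarrow> x = last xs"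
    by auto
  have n: "\<not> adj p3 x" "x \<noteq> p1" "x \<noteq> p2" "x \<noteq> p3" "x \<noteq> p4" if "x \<in> set xs" for x
    using that xs(3) K(4) dj by (auto simp: nbr_def)
  have ni: "p1 \<notin> set xs" "p2 \<notin> set xs" "p3 \<notin> set xs" "p4 \<notin> set xs"
    "hd xs \<in> set xs" "last xs \<in> set xs" using xs(2,3) dj by auto
  have m: "x \<in> set xs \<Longrightarrow> adj x p2 \<longleftrightarrow> x = hd xs" for x using xs(4) adj_commute by metis
  have q: "ipath (rev xs @ [p2])"
    using xs(1,2) m n ni P4_V[OF P] by (auto simp: ipath_append ipath_rev last_rev)
  have r: "ipath (p4 # rev xs @ [p2])"
    using q xs n ni P4_V[OF P] P4_distinct[OF P] P
    by (auto simp: hd_append hd_rev P4_def adj_commute)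
  have "\<not> 2 \<le> length xs"
  proof
    assume "2 \<le> length xs"
    then have "hole p3 (p4 # rev xs @ [p2])"
      using r n ni P4_V[OF P] P4_distinct[OF P] P unfolding hole_def by (auto simp: P4_def adj_commute)
    then show False using nh by blast
  qed
  then have "hd xs = last xs" "hd xs \<in> set xs" using xs(2) by (cases xs; cases "tl xs"; auto)+
  then have "hd xs \<in> K" "adj p2 (hd xs)" "adj p4 (hd xs)" using xs by auto
  then show ?thesis using that by blast
qed

lemma comp_ex_nbr:
  assumes tc: two_connected and K: "is_comp (V - P) K" and P: "p \<in> V" "q \<in> P \<inter> V" "q \<noteq> p" "p \<in> P"
  obtains r where "r \<in> P" "r \<noteq> p" "nbr r K"
proof -
  note Kd = is_compD[OF K]
  have "q \<in> V - {p} - K" "K \<subseteq> V - {p}" using Kd P by auto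
  then have "touch K (V - {p} - K)" using two_connected_touch[OF tc, of K p] Kd by blast
  then obtain x y where xy: "x \<in> K" "adj x y" "y \<notin> K" "y \<noteq> p" "y \<in> V" by (auto simp: touch_iff)
  then have "y \<in> P" using Kd(3) by (auto simp: touch_iff)
  moreover have "nbr y K" using xy adj_commute[of x y] by (auto simp: nbr_def)
  ultimately show ?thesis using that xy by blast
qed

text \<open>As the edge \<open>p2 p3\<close> is not a thick cut, \<open>p1\<close> and
  \<open>p4\<close> lie in one component of \<open>V - {p2, p3}\<close>. Stripping off
  \<open>p1\<close> and then \<open>p4\<close> leaves a connected set \<open>Y\<close> attached to
  both.\<close>

lemma P4_ends_comp:
  assumes np: "\<And>a c. \<not> thick_cut a c" and P: "P4 p1 p2 p3 p4"
  obtains J where "is_comp (V - {p1, p2, p3, p4}) J" "nbr p1 J" "nbr p4 J"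
proof -
  let ?S = "V - {p2, p3}"
  note d = P4_distinct[OF P] and v = P4_V[OF P]
  obtain W where W: "is_comp ?S W" "p1 \<in> W" using ex_comp[of p1 ?S] d v by auto
  note Wd = is_compD[OF W(1)]
  have p4: "p4 \<in> W"
  proof (rule ccontr)
    assume "p4 \<notin> W"
    then have "p4 \<in> ?S - W" using v d by auto
    then have "thick_cut p2 p3" using P Wd by (intro thick_cutI2[of p2 p3 W]) (auto simp: P4_def)
    then show False using np by blast
  qed
  obtain X where X: "is_comp (W - {p1}) X" "p4 \<in> X"
    using ex_comp[of p4 "W - {p1}"] p4 d Wd by auto
  note Xd = is_compD[OF X(1)]
  have "nbr p1 X" using comp_touch[OF Wd(2) X(1)] W(2) by auto
  then obtain y where y: "y \<in> X" "adj p1 y" by (auto simp: nbr_def)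
  then have "y \<noteq> p4" using P by (auto simp: P4_def)
  then obtain Y where Y: "is_comp (X - {p4}) Y" "y \<in> Y"
    using ex_comp[of y "X - {p4}"] y Xd by auto
  note Yd = is_compD[OF Y(1)]
  have "nbr p4 Y" using comp_touch[OF Xd(2) Y(1)] X(2) by auto
  moreover have "nbr p1 Y" using y Y by (auto simp: nbr_def)
  moreover have YV: "Y \<subseteq> V - {p1, p2, p3, p4}" using Yd Xd Wd by blast
  moreover obtain J where J: "is_comp (V - {p1, p2, p3, p4}) J" "y \<in> J"
    using ex_comp[of y "V - {p1, p2, p3, p4}"] Y(2) YV by blast
  ultimately have "Y \<subseteq> J" using comp_absorb[OF J(1) Yd(2)] Y(2) by blast
  then show ?thesis using that[OF J(1)] nbr_mono \<open>nbr p4 Y\<close> \<open>nbr p1 Y\<close> by blast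
qed

text \<open>The hub \<open>{p2, p3}\<close> with path \<open>K\<close>, \<open>p1\<close>,
  \<open>J\<close>, \<open>p4\<close> is a gem.\<close>

lemma P4_gem_end:
  assumes gf: gemfree and P: "P4 p1 p2 p3 p4"
    and J: "conn J" "nbr p1 J" "nbr p4 J" "nbr p2 J \<or> nbr p3 J"
    and K: "conn K" "nbr p1 K" "\<not> nbr p4 K" "nbr p2 K \<or> nbr p3 K"
    and dj: "\<not> touch J K" "J \<inter> K = {}" "{p1, p2, p3, p4} \<inter> (J \<union> K) = {}"
  shows False
proof -
  note v = P4_V[OF P]
  have "conn {p2, p3}" using conn_insert[of "{p3}" p2] P v by (auto simp: P4_def)
  then show False
    using P4_distinct[OF P] P v J K dj
    by (intro gem_False[OF gf, of "{p2, p3}" K "{p1}" J "{p4}"])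
      (auto simp: P4_def adj_commute touch_commute)
qed

text \<open>The hub \<open>insert p2 J\<close> with path \<open>p1\<close>, \<open>K\<close>,
  \<open>p4\<close>, \<open>p3\<close> is a gem. This will keep two components from sharing the
  middle vertex \<open>p2\<close>.\<close>

lemma P4_gem_twins:
  assumes gf: gemfree and P: "P4 p1 p2 p3 p4"
    and J: "conn J" "nbr p2 J" "nbr p4 J"
    and K: "conn K" "nbr p1 K" "nbr p2 K" "nbr p4 K" "\<not> nbr p3 K"
    and dj: "\<not> touch J K" "J \<inter> K = {}" "{p1, p2, p3, p4} \<inter> (J \<union> K) = {}"
  shows False
  using P4_distinct[OF P] P P4_V[OF P] J K dj conn_insert[of J p2]
  by (intro gem_False[OF gf, of "insert p2 J" "{p1}" K "{p4}" "{p3}"])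
    (auto simp: P4_def adj_commute touch_commute)

text \<open>A component attached to both ends sees a middle vertex, or there is a long hole, and not
  both, or it is a hub over the \<open>P4\<close>. One such component \<open>J\<close> exists by
  \<open>P4_ends_comp\<close>. Compared with \<open>J\<close>, a component attached to one end only
  contradicts \<open>P4_gem_end\<close>; one attached to neither end makes the edge
  \<open>p2 p3\<close> a thick cut.\<close>

lemma P4_comp_type:
  assumes gf: gemfree and tc: two_connected and np: "\<And>a c. \<not> thick_cut a c"
    and nh: "\<And>b xs. \<not> hole b xs" and P: "P4 p1 p2 p3 p4"
    and K: "is_comp (V - {p1, p2, p3, p4}) K"
  shows "nbr p1 K" "nbr p4 K" "nbr p2 K \<longleftrightarrow> \<not> nbr p3 K"
proof -
  let ?P = "{p1, p2, p3, p4}"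
  note d = P4_distinct[OF P] and v = P4_V[OF P]
  have mid: "nbr p2 W \<longleftrightarrow> \<not> nbr p3 W" if W: "is_comp (V - ?P) W" "nbr p1 W" "nbr p4 W" for W
  proof -
    note Wd = is_compD[OF W(1)]
    have "nbr p2 W \<or> nbr p3 W"
      using P4_closing_hole[OF P Wd(2) W(2,3)] nh Wd(1) by blast
    moreover have "\<not> (nbr p2 W \<and> nbr p3 W)"
      using gem_False[OF gf Wd(2), of "{p1}" "{p2}" "{p3}" "{p4}"] W(2,3) P v d Wd(1)
      by (auto simp: P4_def adj_commute touch_commute)
    ultimately show ?thesis by blast
  qed
  obtain J where J: "is_comp (V - ?P) J" "nbr p1 J" "nbr p4 J" using P4_ends_comp[OF np P] by blast
  note Ed = is_compD[OF J(1)] and Kd = is_compD[OF K]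
  have "nbr p1 K \<and> nbr p4 K"
  proof (cases "K = J")
    case False
    have E23: "nbr p2 J \<or> nbr p3 J" using mid J by blast
    have EK: "\<not> touch J K" "J \<inter> K = {}" using comps_ntouch[OF J(1) K] False by auto
    have dj: "?P \<inter> (J \<union> K) = {}" using Ed(1) Kd(1) by auto
    have 14: "nbr p4 K" if "nbr p1 K"
    proof (rule ccontr)
      assume n4: "\<not> nbr p4 K"
      obtain r where "r \<in> ?P" "r \<noteq> p1" "nbr r K" using comp_ex_nbr[OF tc K, of p1 p2] v d by auto
      then have "nbr p2 K \<or> nbr p3 K" using n4 by auto
      then show False using P4_gem_end[OF gf P Ed(2) J(2,3) E23 Kd(2) that n4 _ EK dj] by blast
    qed
    have 41: "nbr p1 K" if "nbr p4 K"
    proof (rule ccontr)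
      assume n1: "\<not> nbr p1 K"
      obtain r where "r \<in> ?P" "r \<noteq> p4" "nbr r K" using comp_ex_nbr[OF tc K, of p4 p2] v d by auto
      then have "nbr p2 K \<or> nbr p3 K" using n1 by auto
      moreover have "{p4, p3, p2, p1} \<inter> (J \<union> K) = {}" using dj by auto
      ultimately show False
        using P4_gem_end[OF gf P4_rev[OF P] Ed(2) J(3,2) _ Kd(2) that n1 _ EK] E23 by blast
    qed
    have "nbr p1 K \<or> nbr p4 K"
    proof (rule ccontr)
      assume n: "\<not> ?thesis"
      have "\<not> touch K (V - {p2, p3} - K)"
      proof
        assume "touch K (V - {p2, p3} - K)"
        then obtain y where "y \<in> V - {p2, p3} - K" "nbr y K"
          using touch_commute[of K] by (auto simp: touch_def)
        then show False using n Kd(3) touchI2[of y K "V - ?P - K"] by auto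
      qed
      then have "thick_cut p2 p3"
        using P Kd v d by (intro thick_cutI2[of p2 p3 K]) (auto simp: P4_def)
      then show False using np by blast
    qed
    then show ?thesis using 14 41 by blast
  qed (use J in simp)
  then show "nbr p1 K" "nbr p4 K" "nbr p2 K \<longleftrightarrow> \<not> nbr p3 K" using mid[OF K] by blast+
qed

text \<open>\<open>P4_gem_twins\<close> excludes a common middle vertex \<open>p2\<close> and, read
  along the reversed path, a common \<open>p3\<close>.\<close>

lemma P4_comp_diff:
  assumes gf: gemfree and tc: two_connected and np: "\<And>a c. \<not> thick_cut a c"
    and nh: "\<And>b xs. \<not> hole b xs" and P: "P4 p1 p2 p3 p4"
    and J: "is_comp (V - {p1, p2, p3, p4}) J" and K: "is_comp (V - {p1, p2, p3, p4}) K" and ne: "J \<noteq> K"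
  shows "nbr p2 J \<longleftrightarrow> \<not> nbr p2 K"
proof -
  note Et = P4_comp_type[OF gf tc np nh P J] and Kt = P4_comp_type[OF gf tc np nh P K]
  note Ed = is_compD[OF J] and Kd = is_compD[OF K]
  have EK: "\<not> touch J K" "J \<inter> K = {}" using comps_ntouch[OF J K] ne by auto
  have dj: "{p1, p2, p3, p4} \<inter> (J \<union> K) = {}" "{p4, p3, p2, p1} \<inter> (J \<union> K) = {}"
    using Ed(1) Kd(1) by auto
  show ?thesis
    using P4_gem_twins[OF gf P Ed(2) _ Et(2) Kd(2) Kt(1) _ Kt(2) _ EK dj(1)]
      P4_gem_twins[OF gf P4_rev[OF P] Ed(2) _ Et(1) Kd(2) Kt(2) _ Kt(1) _ EK dj(2)] Et(3) Kt(3)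
    by blast
qed

text \<open>The vertex \<open>d\<close> of \<open>J\<close> adjacent to \<open>p2\<close> and \<open>p4\<close> lies on a second induced path, \<open>p1 d p4 p3\<close> or
  \<open>p1 p2 d p4\<close>; applying \<open>P4_comp_type\<close> to it leaves no room for another vertex of \<open>J\<close>.\<close>

lemma P4_comp_single:
  assumes gf: gemfree and tc: two_connected and np: "\<And>a c. \<not> thick_cut a c"
    and nh: "\<And>b xs. \<not> hole b xs" and P: "P4 p1 p2 p3 p4"
    and J: "is_comp (V - {p1, p2, p3, p4}) J" and b: "nbr p2 J"
  shows "\<exists>d. J = {d}"
proof -
  let ?P = "{p1, p2, p3, p4}"
  note dist = P4_distinct[OF P] and v = P4_V[OF P]
  note Et = P4_comp_type[OF gf tc np nh P J] and Ed = is_compD[OF J]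
  have E3: "\<not> nbr p3 J" using Et b by blast
  have PE: "?P \<inter> J = {}" using Ed(1) by blast
  obtain d where d: "d \<in> J" "adj p2 d" "adj p4 d"
    using P4_common_nbr[OF nh P Ed(2) b Et(2) E3 PE] by blast
  have dn: "\<not> adj p3 d" "d \<noteq> p1" "d \<noteq> p2" "d \<noteq> p3" "d \<noteq> p4" "d \<in> V"
    using d E3 PE Ed(5) by (auto simp: nbr_def)
  \<comment> \<open>A component besides \<open>J\<close> must have \<open>p3\<close> as its middle
    vertex; \<open>F\<close> becomes part of the hub of the gems below.\<close>
  have other: "\<exists>F. conn F \<and> nbr p1 F \<and> nbr p4 F \<and> \<not> nbr p2 F \<and> nbr p3 F \<and> F \<inter> ?P = {} \<and> F \<inter> J = {} \<and> \<not> touch F J"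
    if "V \<noteq> ?P \<union> J"
  proof -
    have "V - ?P - J \<noteq> {}"
    proof
      assume "V - ?P - J = {}"
      then have "V = ?P \<union> J" using Ed(5) v by auto
      then show False using that by blast
    qed
    then obtain x where "x \<in> V - ?P" "x \<notin> J" by blast
    then obtain F where F: "is_comp (V - ?P) F" "x \<in> F" using ex_comp[of x "V - ?P"] by blast
    then have "J \<noteq> F" using \<open>x \<notin> J\<close> by blast
    then show ?thesis
      using P4_comp_diff[OF gf tc np nh P J F(1)] P4_comp_type[OF gf tc np nh P F(1)]
        comps_ntouch[OF F(1) J] is_compD[OF F(1)] b by blast
  qed
  have Wout: "y = d \<or> y \<in> ?P" if "is_comp (J - {d}) W" "w \<in> W" "adj w y" "y \<notin> W" for W w y
  proof (rule ccontr)
    assume n: "\<not> ?thesis"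
    note Wd = is_compD[OF that(1)]
    have "y \<in> V" using adj_in_V[OF that(3)] by blast
    moreover have "y \<in> J"
      using n Ed(3) that(2,3) Wd(1) \<open>y \<in> V\<close> by (auto simp: touch_iff)
    ultimately show False using n Wd(3) that by (auto simp: touch_iff)
  qed
  have Wd': "nbr d W" if "is_comp (J - {d}) W" for W
    using comp_touch[OF Ed(2) that] d by auto
  show ?thesis
  proof (cases "adj p1 d")
    case True
    have Q: "P4 p1 d p4 p3" using True d dn P by (auto simp: P4_def adj_commute)
    \<comment> \<open>If \<open>W\<close> missed \<open>p2\<close>, it would be a component of the
      complement of \<open>p1 d p4 p3\<close>, hence attached to the end \<open>p3\<close>, which
      \<open>J\<close> is not. So \<open>W\<close> lies together with \<open>p2\<close> in
      \<open>X\<close>, whose middle vertex is \<open>d\<close> and therefore not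
      \<open>p4\<close>.\<close>
    have W: "nbr p2 W \<and> \<not> nbr p4 W" if W: "is_comp (J - {d}) W" for W
    proof -
      note Wd = is_compD[OF W]
      have W2: "nbr p2 W"
      proof (rule ccontr)
        assume n2: "\<not> nbr p2 W"
        have "\<not> touch W (V - {p1, d, p4, p3} - W)"
        proof
          assume "touch W (V - {p1, d, p4, p3} - W)"
          then obtain w y where wy: "w \<in> W" "adj w y" "y \<notin> W" "y \<notin> {p1, d, p4, p3}"
            by (auto simp: touch_iff)
          then have "y = p2" using Wout[OF W wy(1-3)] by auto
          then show False using n2 wy adj_commute by (auto simp: nbr_def)
        qed
        then have "is_comp (V - {p1, d, p4, p3}) W" using Wd Ed(1) by (auto simp: is_comp_def)
        then have "nbr p3 W" using P4_comp_type[OF gf tc np nh Q] by blast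
        then show False using E3 nbr_mono Wd(1) by blast
      qed
      have "p2 \<in> V - {p1, d, p4, p3}" using v dist dn by auto
      then obtain X where X: "is_comp (V - {p1, d, p4, p3}) X" "p2 \<in> X"
        using ex_comp[of p2 "V - {p1, d, p4, p3}"] by blast
      have "insert p2 W \<subseteq> X"
        using comp_absorb[OF X(1) conn_insert[OF Wd(2) W2]] X(2) Wd(1) Ed(1) v dist dn by auto
      moreover have "nbr d X" using X(2) d(2) adj_commute[of p2 d] by (auto simp: nbr_def)
      moreover have "nbr d X \<longleftrightarrow> \<not> nbr p4 X" using P4_comp_type(3)[OF gf tc np nh Q X(1)] .
      ultimately show ?thesis using W2 nbr_mono by blast
    qed
    have n4: "\<not> nbr p4 (J - {d})"
    proof
      assume "nbr p4 (J - {d})"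
      then obtain x where x: "x \<in> J - {d}" "adj p4 x" by (auto simp: nbr_def)
      then obtain W' where "is_comp (J - {d}) W'" "x \<in> W'"
        using ex_comp[of x "J - {d}"] Ed(5) by blast
      then show False using W x by (auto simp: nbr_def)
    qed
    have "J - {d} = {}"
    proof (rule ccontr)
      assume "J - {d} \<noteq> {}"
      then obtain W where W': "is_comp (J - {d}) W" using ex_comp[of _ "J - {d}"] Ed(5) by blast
      note Wd = is_compD[OF W']
      have W24: "nbr p2 W" "\<not> nbr p4 W" "\<not> nbr p3 W"
        using W[OF W'] E3 nbr_mono[of p3 W J] Wd(1) by auto
      have "nbr p1 W"
      proof (rule ccontr)
        assume n1: "\<not> nbr p1 W"
        have "\<not> touch W (V - {p2, d} - W)"
        proof
          assume "touch W (V - {p2, d} - W)"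
          then obtain w y where wy: "w \<in> W" "adj w y" "y \<notin> W" "y \<notin> {p2, d}"
            by (auto simp: touch_iff)
          then have "nbr y W" using adj_commute[of w y] by (auto simp: nbr_def)
          then show False using Wout[OF W' wy(1-3)] wy(4) n1 W24 by auto
        qed
        moreover have "W \<subseteq> V - {p2, d}" "p1 \<in> V - {p2, d} - W" using Wd Ed(1) v dist dn by auto
        ultimately have "thick_cut p2 d" using d(2) Wd(4) by (intro thick_cutI2[of p2 d W]) auto
        then show False using np by blast
      qed
      \<comment> \<open>Otherwise the edge \<open>p2 d\<close> would separate \<open>p1\<close> and
        \<open>J - {d}\<close> from \<open>p3\<close> and \<open>p4\<close>.\<close>
      have "V \<noteq> ?P \<union> J"
      proof
        assume VE: "V = ?P \<union> J"
        let ?A = "insert p1 (J - {d})"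
        have "V - {p2, d} - ?A = {p3, p4}" using VE PE dist dn d(1) by auto
        moreover have "\<not> nbr p3 (J - {d})" using E3 nbr_mono[of p3 "J - {d}" J] by auto
        ultimately have "\<not> touch ?A (V - {p2, d} - ?A)" "V - {p2, d} - ?A \<noteq> {}"
          using n4 P by (auto simp: P4_def adj_commute)
        moreover have "?A \<subseteq> V - {p2, d}" using Ed PE v dist dn by auto
        ultimately have "thick_cut p2 d" using d(2) by (intro thick_cutI2[of p2 d ?A]) auto
        then show False using np by blast
      qed
      then obtain F where F: "conn F" "nbr p1 F" "nbr p4 F" "\<not> nbr p2 F" "nbr p3 F" "F \<inter> ?P = {}"
        "F \<inter> J = {}" "\<not> touch F J" using other by blast
      have "W \<inter> insert p1 F = {}" "?P \<inter> W = {}" using F Wd PE by auto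
      then show False
        using F conn_insert[OF F(1,2)] P v dist Wd(2) W24 \<open>nbr p1 W\<close>
        by (intro gem_False[OF gf, of "insert p1 F" W "{p2}" "{p3}" "{p4}"])
          (auto simp: P4_def adj_commute touch_commute)
    qed
    then show ?thesis using d by blast
  next
    case False
    have Q: "P4 p1 p2 d p4" using False d dn P by (auto simp: P4_def adj_commute)
    \<comment> \<open>Otherwise \<open>{p3}\<close> would be a component of the complement of
      \<open>p1 p2 d p4\<close>, although \<open>p3\<close> is not adjacent to the end
      \<open>p1\<close>.\<close>
    have "V \<noteq> ?P \<union> J"
    proof
      assume VE: "V = ?P \<union> J"
      have "V - {p1, p2, d, p4} - {p3} \<subseteq> J" using VE by auto
      then have "\<not> touch {p3} (V - {p1, p2, d, p4} - {p3})" using E3 nbr_mono by auto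
      then have "is_comp (V - {p1, p2, d, p4}) {p3}" using v dist dn by (auto simp: is_comp_def)
      then have "nbr p1 {p3}" using P4_comp_type(1)[OF gf tc np nh Q] by blast
      then show False using P by (auto simp: P4_def)
    qed
    then obtain F where F: "conn F" "nbr p1 F" "nbr p4 F" "\<not> nbr p2 F" "nbr p3 F" "F \<inter> ?P = {}"
      "F \<inter> J = {}" "\<not> touch F J" using other by blast
    \<comment> \<open>\<open>p1\<close> sees \<open>J\<close> but not \<open>d\<close>, so
      \<open>J\<close> has another vertex. A component \<open>W\<close> of \<open>J - {d}\<close>
      turns out to be a component of the complement of \<open>p1 p2 d p4\<close>; being attached to
      \<open>d\<close>, it misses \<open>p2\<close>.\<close>
    obtain z where "z \<in> J - {d}" using Et(1) False by (auto simp: nbr_def)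
    then obtain W where W: "is_comp (J - {d}) W" using ex_comp[of z "J - {d}"] Ed(5) by blast
    note Wd = is_compD[OF W]
    have W3: "\<not> nbr p3 W" using E3 nbr_mono[of p3 W J] Wd(1) by auto
    have "\<not> touch W (V - {p1, p2, d, p4} - W)"
    proof
      assume "touch W (V - {p1, p2, d, p4} - W)"
      then obtain w y where wy: "w \<in> W" "adj w y" "y \<notin> W" "y \<notin> {p1, p2, d, p4}"
        by (auto simp: touch_iff)
      then have "y = p3" using Wout[OF W wy(1-3)] by auto
      then show False using W3 wy adj_commute by (auto simp: nbr_def)
    qed
    then have "is_comp (V - {p1, p2, d, p4}) W" using Wd Ed(1) by (auto simp: is_comp_def)
    then have Wt: "nbr p1 W" "nbr p4 W" "nbr p2 W \<longleftrightarrow> \<not> nbr d W"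
      using P4_comp_type[OF gf tc np nh Q] by blast+
    then have W2: "\<not> nbr p2 W" using Wd'[OF W] by blast
    have c: "conn (insert p4 (insert p1 F))" using conn_insert F(1-3) by auto
    have dj: "W \<inter> F = {}" "?P \<inter> W = {}" "d \<notin> W" "d \<notin> F" using F Wd PE d by auto
    have False
      using F c P v dist Wd(2) W2 W3 Wt Wd'[OF W] d dn dj False
      by (intro gem_False[OF gf, of "insert p4 (insert p1 F)" W "{d}" "{p2}" "{p3}"])
        (auto simp: P4_def adj_commute touch_commute)
    then show ?thesis ..
  qed
qed

text \<open>The components are singletons, and attachment to \<open>p2\<close> is a two-valued mark
  on which any two of them differ. So there are at most two, besides the four path vertices.\<close>

lemma no_hole_card:
  assumes gf: gemfree and tc: two_connected and np: "\<And>a c. \<not> thick_cut a c"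
    and nh: "\<And>b xs. \<not> hole b xs" and P: "P4 p1 p2 p3 p4"
  shows "card V \<le> 6"
proof -
  let ?P = "{p1, p2, p3, p4}"
  have single: "is_comp (V - ?P) {x}" if x: "x \<in> V - ?P" for x
  proof -
    obtain J where J: "is_comp (V - ?P) J" "x \<in> J" using ex_comp[of x "V - ?P"] x by blast
    have "\<exists>d. J = {d}"
    proof (cases "nbr p2 J")
      case True
      then show ?thesis using P4_comp_single[OF gf tc np nh P J(1)] by blast
    next
      case False
      then have "nbr p3 J" using P4_comp_type[OF gf tc np nh P J(1)] by blast
      moreover have "{p4, p3, p2, p1} = ?P" by auto
      ultimately show ?thesis
        using P4_comp_single[OF gf tc np nh P4_rev[OF P]] J(1) by metis
    qed
    then show ?thesis using J by auto
  qed
  have "card (V - ?P) \<le> 2"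
  proof (rule ccontr)
    assume "\<not> ?thesis"
    then obtain T where T: "T \<subseteq> V - ?P" "card T = 3"
      using obtain_subset_with_card_n[of 3 "V - ?P"] by auto
    then obtain x y z where xyz: "T = {x, y, z}" "x \<noteq> y" "x \<noteq> z" "y \<noteq> z" by (auto simp: card_3_iff)
    have diff: "nbr p2 {u} \<longleftrightarrow> \<not> nbr p2 {w}" if "u \<in> T" "w \<in> T" "u \<noteq> w" for u w
      using P4_comp_diff[OF gf tc np nh P single single, of u w] that T(1) by blast
    show False using diff[of x y] diff[of y z] diff[of x z] xyz by simp
  qed
  moreover have "card V \<le> card ?P + card (V - ?P)"
  proof -
    have "card V \<le> card (?P \<union> (V - ?P))" by (rule card_mono) (use finite_V in auto)
    also have "\<dots> \<le> card ?P + card (V - ?P)" by (rule card_Un_le)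
    finally show ?thesis .
  qed
  moreover have "card ?P \<le> 4" using P4_distinct[OF P] by simp
  ultimately show ?thesis by linarith
qed

theorem gemfree_decomposition:
  assumes gf: gemfree and tc: two_connected
  shows "\<exists>X\<subseteq>V. card X \<le> 6 \<and> (\<forall>D. is_comp (V - X) D \<longrightarrow> good D)"
proof (cases "\<exists>a c. thick_cut a c")
  case True
  then obtain a c where ac: "thick_cut a c" by blast
  then have "{a, c} \<subseteq> V" "card {a, c} \<le> 6" by (auto simp: thick_cut_def)
  then show ?thesis using thick_cut_good[OF gf tc ac] by blast
next
  case False
  then have np: "\<And>a c. \<not> thick_cut a c" by blast
  show ?thesis
  proof (cases "\<exists>b xs. hole b xs")
    case True
    then obtain b xs where "hole b xs" by blast
    from hole_good[OF gf tc np this] obtain X where X: "X \<subseteq> V" "card X \<le> 2"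
      "\<And>D. is_comp (V - X) D \<Longrightarrow> good D" by blast
    then show ?thesis by (intro exI[of _ X]) auto
  next
    case nh: False
    show ?thesis
    proof (cases "p4free V")
      case True
      have "good D" if "is_comp (V - {}) D" for D
        using True is_compD(1)[OF that] unfolding good_def p4free_def by blast
      then show ?thesis by (intro exI[of _ "{}"]) auto
    next
      case False
      then obtain p q r s where "P4 p q r s" by (auto simp: p4free_def)
      then have "card V \<le> 6" using no_hole_card[OF gf tc np] nh by blast
      \<comment> \<open>Deleting all of \<open>V\<close> leaves no component, since components are
        nonempty. This is the only case that needs the bound 6.\<close>
      then show ?thesis by (intro exI[of _ V]) (auto dest: is_compD)
    qed
  qed
qed

end

section \<open>Gem models and induced minors\<close>

text \<open>Label 4 is the vertex of degree four of the gem; vertices labelled 5 or more are to be deleted.\<close>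

definition gem_model :: "'a pair_pre_digraph \<Rightarrow> ('a \<Rightarrow> nat) \<Rightarrow> bool" where
  "gem_model H c \<longleftrightarrow>
     (\<forall>i<5. sgraph.conn (pverts H) (parcs H) {v \<in> pverts H. c v = i}) \<and>
     (\<forall>i<5. \<forall>j<5. i \<noteq> j \<longrightarrow>
        (sgraph.touch (parcs H) {v \<in> pverts H. c v = i} {v \<in> pverts H. c v = j} \<longleftrightarrow> (i, j) \<in> parcs gem))"

lemma pair_graph_sgraph:
  assumes "pair_graph G"
  shows "sgraph (pverts G) (parcs G)"
proof -
  interpret pair_graph G by fact
  show ?thesis
  proof
    show "finite (pverts G)" by (rule pair_finite_verts)
    show "parcs G \<subseteq> pverts G \<times> pverts G" using in_arcsD1 in_arcsD2 by auto
    show "sym (parcs G)" using arcs_symmetric by (auto simp: sym_def)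
    show "(x, x) \<notin> parcs G" for x using no_loops' by blast
  qed
qed

lemma sgraph_pair_graph:
  assumes "sgraph (pverts G) (parcs G)"
  shows "pair_graph G"
proof -
  interpret sgraph "pverts G" "parcs G" by fact
  show ?thesis
  proof
    show "finite (parcs G)" using finite_V E_sub finite_subset by blast
    show "symmetric (with_proj G)" using sym_E by (simp add: symmetric_def)
  qed (use finite_V E_sub irrefl_E in auto)
qed

lemma gem_arc_iff: "(i, j) \<in> parcs gem \<longleftrightarrow>
    i < 4 \<and> j < 4 \<and> (j = Suc i \<or> i = Suc j) \<or> i = 4 \<and> j < 4 \<or> i < 4 \<and> j = 4"
  by (auto simp: gem_def path4_def)

lemma gem_pverts: "pverts gem = {..<5}"
  by (auto simp: gem_def path4_def)

lemma wf_gem: "wf_digraph (with_proj gem)"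
  unfolding wf_digraph_wp_iff by unfold_locales (auto simp: gem_def path4_def)

lemma delete_gem_model:
  assumes sg: "sgraph (pverts H) (parcs H)" and m: "gem_model H c"
    and v: "5 \<le> c v" and H': "H' = \<lparr>pverts = pverts H - {v}, parcs = {e \<in> parcs H. fst e \<noteq> v \<and> snd e \<noteq> v}\<rparr>"
  shows "sgraph (pverts H') (parcs H')" "gem_model H' c"
proof -
  interpret H: sgraph "pverts H" "parcs H" by fact
  show sg': "sgraph (pverts H') (parcs H')"
    using H.finite_V H.E_sub H.sym_E H.irrefl_E unfolding H' by unfold_locales (auto simp: sym_def)
  interpret H': sgraph "pverts H'" "parcs H'" by fact
  have part: "{w \<in> pverts H'. c w = i} = {w \<in> pverts H. c w = i}" if "i < 5" for i
    using that v by (auto simp: H')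
  have adj': "H'.adj x y \<longleftrightarrow> H.adj x y \<and> x \<noteq> v \<and> y \<noteq> v" for x y
    unfolding H'.adj_def H.adj_def by (simp add: H')
  have touch: "H'.touch A B \<longleftrightarrow> H.touch A B" if "v \<notin> A" "v \<notin> B" for A B
    using that unfolding H.touch_iff H'.touch_iff adj' by blast
  have conn: "H'.conn A" if "H.conn A" "v \<notin> A" for A
    unfolding H'.conn_def
  proof (intro conjI allI impI)
    show "A \<noteq> {}" "A \<subseteq> pverts H'" using that H.connD by (auto simp: H')
    fix B assume "B \<noteq> {}" "B \<subset> A"
    then have "H.touch B (A - B)" using that by (auto simp: H.conn_def)
    then show "H'.touch B (A - B)" using touch[of B "A - B"] \<open>B \<subset> A\<close> that by auto
  qed
  have nv: "v \<notin> {w \<in> pverts H. c w = i}" if "i < 5" for i using that v by auto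
  show "gem_model H' c"
    unfolding gem_model_def
  proof (intro conjI allI impI)
    fix i :: nat assume i: "i < 5"
    show "H'.conn {w \<in> pverts H'. c w = i}"
      using m i conn[OF _ nv[OF i]] by (simp add: part gem_model_def)
    fix j :: nat assume j: "j < 5" "i \<noteq> j"
    show "H'.touch {w \<in> pverts H'. c w = i} {w \<in> pverts H'. c w = j} \<longleftrightarrow> (i, j) \<in> parcs gem"
      using m i j touch[OF nv[OF i] nv[OF j(1)]] by (simp add: part gem_model_def)
  qed
qed

text \<open>The merging map \<open>f\<close> preserves labels, so each branch set is replaced by its
  image: connectivity and contacts survive, and no contact between different labels arises.\<close>

lemma contract_gem_model:
  assumes sg: "sgraph (pverts H) (parcs H)" and m: "gem_model H c"
    and uv: "(u, v) \<in> parcs H" "c u = c v"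
  shows "sgraph (pverts (contract_edge H u v)) (parcs (contract_edge H u v))"
    "gem_model (contract_edge H u v) c" "pverts (contract_edge H u v) = pverts H - {v}"
proof -
  interpret H: sgraph "pverts H" "parcs H" by fact
  define f where "f = id(v := u)"
  let ?H' = "contract_edge H u v"
  have V': "pverts ?H' = f ` pverts H"
    and E': "parcs ?H' = {(f x, f y) | x y. (x, y) \<in> parcs H \<and> f x \<noteq> f y}"
    by (simp_all add: contract_edge_def f_def Let_def)
  have uvV: "u \<in> pverts H" "v \<in> pverts H" "u \<noteq> v" using uv H.E_sub H.irrefl_E by auto
  show "pverts ?H' = pverts H - {v}" using uvV unfolding V' by (auto simp: f_def)
  have cf: "c (f x) = c x" for x using uv by (simp add: f_def)
  have fV: "f x \<in> pverts H" if "x \<in> pverts H" for x using that uvV by (simp add: f_def)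
  show sg': "sgraph (pverts ?H') (parcs ?H')"
  proof
    show "finite (pverts ?H')" using H.finite_V V' by simp
    show "parcs ?H' \<subseteq> pverts ?H' \<times> pverts ?H'" using H.E_sub unfolding V' E' by auto
    show "sym (parcs ?H')" using H.sym_E unfolding E' by (fastforce simp: sym_def)
    show "(x, x) \<notin> parcs ?H'" for x unfolding E' by auto
  qed
  interpret H': sgraph "pverts ?H'" "parcs ?H'" by fact
  define part where "part i = {w \<in> pverts H. c w = i}" for i
  have part': "{w \<in> pverts ?H'. c w = i} = f ` part i" for i
    by (auto simp: V' part_def cf)
  have fadj: "H'.adj (f x) (f y)" if "H.adj x y" "f x \<noteq> f y" for x y
  proof -
    have "(f x, f y) \<in> parcs ?H'" using that unfolding H.adj_def E' by blast
    then show ?thesis by (simp only: H'.adj_def)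
  qed
  have conn: "H'.conn (f ` A)" if A: "H.conn A" for A
    unfolding H'.conn_def
  proof (intro conjI allI impI)
    show "f ` A \<noteq> {}" "f ` A \<subseteq> pverts ?H'" using H.connD[OF A] unfolding V' by blast+
    fix B assume B: "B \<noteq> {}" "B \<subset> f ` A"
    let ?B = "{x \<in> A. f x \<in> B}"
    have "H.touch ?B (A - ?B)" using A B by (intro H.conn_touch) auto
    then obtain x y where "x \<in> A" "f x \<in> B" "y \<in> A" "f y \<notin> B" "H.adj x y"
      by (auto simp: H.touch_iff)
    moreover from this have "f x \<noteq> f y" by auto
    ultimately have "H'.adj (f x) (f y)" "f x \<in> B" "f y \<in> f ` A - B" using fadj by blast+
    then show "H'.touch B (f ` A - B)" unfolding H'.touch_iff by blast
  qed
  have touch: "H'.touch (f ` part i) (f ` part j) \<longleftrightarrow> H.touch (part i) (part j)" if "i \<noteq> j" for i j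
  proof
    assume "H'.touch (f ` part i) (f ` part j)"
    then obtain a b where ab: "a \<in> part i" "b \<in> part j" "(f a, f b) \<in> parcs ?H'"
      by (auto simp: H'.touch_iff H'.adj_def)
    then obtain x y where xy: "f a = f x" "f b = f y" "(x, y) \<in> parcs H" by (auto simp: E')
    have "c x = c a" "c y = c b" using cf[of x] cf[of a] cf[of y] cf[of b] xy(1,2) by simp_all
    then have "c x = i" "c y = j" using ab by (simp_all add: part_def)
    then show "H.touch (part i) (part j)"
      using xy(3) H.E_sub by (auto simp: H.touch_iff H.adj_def part_def)
  next
    assume "H.touch (part i) (part j)"
    then obtain x y where xy: "x \<in> part i" "y \<in> part j" "H.adj x y" by (auto simp: H.touch_iff)
    then have "c (f x) \<noteq> c (f y)" using that by (simp add: cf part_def)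
    then have "f x \<noteq> f y" by auto
    then have "H'.adj (f x) (f y)" using xy fadj by blast
    then show "H'.touch (f ` part i) (f ` part j)" using xy unfolding H'.touch_iff by blast
  qed
  show "gem_model ?H' c"
    using m conn touch unfolding gem_model_def part' unfolding part_def by simp
qed

lemma singleton_gem_model:
  assumes sg: "sgraph (pverts H) (parcs H)" and m: "gem_model H c"
    and lt: "\<And>v. v \<in> pverts H \<Longrightarrow> c v < 5"
    and inj: "\<And>u v. u \<in> pverts H \<Longrightarrow> v \<in> pverts H \<Longrightarrow> c u = c v \<Longrightarrow> u = v"
  shows "digraph_iso (with_proj gem) (with_proj H)"
proof -
  interpret H: sgraph "pverts H" "parcs H" by fact
  have "\<exists>v. v \<in> pverts H \<and> c v = i" if "i < 5" for i
    using m that H.connD(1) unfolding gem_model_def by blast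
  then obtain g where g: "\<And>i. i < 5 \<Longrightarrow> g i \<in> pverts H \<and> c (g i) = i" by metis
  have gc: "g (c v) = v" if "v \<in> pverts H" for v using g[of "c v"] lt inj that by blast
  have part: "{v \<in> pverts H. c v = i} = {g i}" if "i < 5" for i using g[OF that] gc by auto
  have arc: "(g i, g j) \<in> parcs H \<longleftrightarrow> (i, j) \<in> parcs gem" if "i < 5" "j < 5" for i j
  proof (cases "i = j")
    case True
    then show ?thesis using H.irrefl_E by (auto simp: gem_arc_iff)
  next
    case False
    then have "H.touch {v \<in> pverts H. c v = i} {v \<in> pverts H. c v = j} \<longleftrightarrow> (i, j) \<in> parcs gem"
      using m that unfolding gem_model_def by blast
    then have "H.touch {g i} {g j} \<longleftrightarrow> (i, j) \<in> parcs gem"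
      by (simp only: part[OF that(1)] part[OF that(2)])
    moreover have "H.touch {g i} {g j} \<longleftrightarrow> (g i, g j) \<in> parcs H"
      unfolding H.touch_iff H.adj_def by blast
    ultimately show ?thesis by blast
  qed
  let ?f = "\<lparr>iso_verts = g, iso_arcs = map_prod g g, iso_head = snd, iso_tail = fst\<rparr>"
  have inj_g: "inj_on g {..<5}" by (rule inj_on_inverseI[of _ c]) (use g in auto)
  have gem_sub: "parcs gem \<subseteq> {..<5} \<times> {..<5}" by (auto simp: gem_arc_iff)
  have "pre_digraph.digraph_isomorphism (with_proj gem) ?f"
    unfolding pre_digraph.digraph_isomorphism_def
  proof (intro conjI ballI)
    show "wf_digraph (with_proj gem)" by (rule wf_gem)
    show "inj_on (iso_verts ?f) (verts (with_proj gem))" using inj_g by (simp add: gem_pverts)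
    show "inj_on (iso_arcs ?f) (arcs (with_proj gem))"
      using inj_on_subset[OF map_prod_inj_on[OF inj_g inj_g] gem_sub] by simp
  qed simp_all
  moreover have "with_proj H = app_iso ?f (with_proj gem)"
  proof -
    have "pverts H = g ` {..<5}"
    proof (intro equalityI subsetI)
      fix x assume x: "x \<in> pverts H"
      have "g (c x) \<in> g ` {..<5}" using lt x by (intro imageI) simp
      then show "x \<in> g ` {..<5}" using gc x by simp
    next
      fix x assume "x \<in> g ` {..<5}"
      then obtain i where "x = g i" "i < 5" by (auto simp: image_iff)
      then show "x \<in> pverts H" using g by blast
    qed
    moreover have "parcs H = map_prod g g ` parcs gem"
    proof (intro equalityI subsetI)
      fix e assume e: "e \<in> parcs H"
      obtain x y where "e = (x, y)" by (cases e)
      then have xy: "e = (x, y)" "x \<in> pverts H" "y \<in> pverts H" using e H.E_sub by blast+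
      then have "(c x, c y) \<in> parcs gem" using arc[of "c x" "c y"] lt gc e by auto
      moreover have "e = map_prod g g (c x, c y)" using xy gc by simp
      ultimately show "e \<in> map_prod g g ` parcs gem" by (rule rev_image_eqI)
    next
      fix e assume "e \<in> map_prod g g ` parcs gem"
      then show "e \<in> parcs H" using arc gem_sub by auto
    qed
    ultimately show ?thesis by (simp add: app_iso_def with_proj_def gem_pverts)
  qed
  ultimately show ?thesis unfolding digraph_iso_def by blast
qed

text \<open>While a surplus label remains, such a vertex is deleted; while a branch set has two
  vertices, its connectivity provides an edge to contract. Once neither is possible, the labelling
  is an isomorphism to the gem.\<close>

lemma gem_model_induced_minor:
  assumes "sgraph (pverts H) (parcs H)" "gem_model H c" "reduces_to G H"
  shows "induced_minor gem G"
  using assms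
proof (induction "card (pverts H)" arbitrary: H rule: less_induct)
  case less
  interpret H: sgraph "pverts H" "parcs H" by fact
  show ?case
  proof (cases "\<exists>v\<in>pverts H. 5 \<le> c v")
    case True
    then obtain v where v: "v \<in> pverts H" "5 \<le> c v" by blast
    define H' where "H' = \<lparr>pverts = pverts H - {v}, parcs = {e \<in> parcs H. fst e \<noteq> v \<and> snd e \<noteq> v}\<rparr>"
    note d = delete_gem_model[OF less.prems(1,2) v(2) H'_def]
    have "with_proj H' = pre_digraph.del_vert (with_proj H) v"
      by (simp add: pre_digraph.del_vert_def with_proj_def H'_def)
    then have "reduces_to G H'" by (rule reduces_to.delete[OF less.prems(3) v(1)])
    moreover have "card (pverts H') < card (pverts H)"
      unfolding H'_def using v H.finite_V by (intro psubset_card_mono) auto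
    ultimately show ?thesis using less.hyps d by blast
  next
    case lt: False
    show ?thesis
    proof (cases "\<exists>u\<in>pverts H. \<exists>v\<in>pverts H. c u = c v \<and> u \<noteq> v")
      case True
      then obtain x y where xy: "x \<in> pverts H" "y \<in> pverts H" "c x = c y" "x \<noteq> y" by blast
      let ?S = "{w \<in> pverts H. c w = c x}"
      have "c x < 5" using lt xy(1) not_le by blast
      then have "H.conn ?S" using less.prems(2) by (simp add: gem_model_def)
      then have "H.touch {x} (?S - {x})" using xy by (intro H.conn_touch) auto
      then obtain v where "(x, v) \<in> parcs H" "c v = c x"
        unfolding H.touch_iff H.adj_def by auto
      then have v: "(x, v) \<in> parcs H" "c x = c v" by simp_all
      note d = contract_gem_model[OF less.prems(1,2) v]
      have "v \<in> pverts H" using v H.E_sub by auto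
      then have "card (pverts (contract_edge H x v)) < card (pverts H)"
        using H.finite_V unfolding d(3) by (intro psubset_card_mono) auto
      moreover have "reduces_to G (contract_edge H x v)"
        by (rule reduces_to.contract[OF less.prems(3) v(1)])
      ultimately show ?thesis using less.hyps d by blast
    next
      case False
      then have "digraph_iso (with_proj gem) (with_proj H)"
        using singleton_gem_model[OF less.prems(1,2)] lt by (meson not_le_imp_less)
      then show ?thesis using less.prems(3) unfolding induced_minor_def by blast
    qed
  qed
qed

lemma not_induced_minor_gemfree:
  assumes pg: "pair_graph G" and nm: "\<not> induced_minor gem G"
  shows "sgraph.gemfree (pverts G) (parcs G)"
proof -
  have sg: "sgraph (pverts G) (parcs G)" using pair_graph_sgraph pg by blast
  interpret sgraph "pverts G" "parcs G" by fact
  show ?thesis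
    unfolding gemfree_def
  proof (intro allI impI, rule ccontr)
    fix H P Q R S
    assume c: "conn H" "conn P" "conn Q" "conn R" "conn S"
      and d: "H \<inter> (P \<union> Q \<union> R \<union> S) = {}" "P \<inter> (Q \<union> R \<union> S) = {}" "Q \<inter> (R \<union> S) = {}" "R \<inter> S = {}"
      and t: "touch H P" "touch H Q" "touch H R" "touch H S" "touch P Q" "touch Q R" "touch R S"
      and nt: "\<not> (touch P R \<or> touch P S \<or> touch Q S)"
    define lab where "lab v = (if v \<in> P then 0 else if v \<in> Q then 1 else if v \<in> R then 2
      else if v \<in> S then 3 else if v \<in> H then 4 else (5::nat))" for v
    have sub: "H \<subseteq> pverts G" "P \<subseteq> pverts G" "Q \<subseteq> pverts G" "R \<subseteq> pverts G" "S \<subseteq> pverts G"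
      using c connD by blast+
    define part where "part i = {v \<in> pverts G. lab v = i}" for i
    have part: "part 0 = P" "part (Suc 0) = Q" "part 2 = R" "part 3 = S" "part 4 = H"
      using sub d by (auto simp: part_def lab_def split: if_splits)
    have five: "i = 0 \<or> i = Suc 0 \<or> i = 2 \<or> i = 3 \<or> i = 4" if "i < 5" for i :: nat
      using that by linarith
    have tv: "touch H P = True" "touch H Q = True" "touch H R = True" "touch H S = True"
      "touch P Q = True" "touch Q R = True" "touch R S = True"
      "touch P H = True" "touch Q H = True" "touch R H = True" "touch S H = True"
      "touch Q P = True" "touch R Q = True" "touch S R = True"
      "touch P R = False" "touch P S = False" "touch Q S = False"
      "touch R P = False" "touch S P = False" "touch S Q = False"
      using t nt by (simp_all add: touch_commute)
    have "gem_model G lab"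
      unfolding gem_model_def part_def[symmetric]
    proof (intro conjI allI impI)
      fix i :: nat assume i: "i < 5"
      show "conn (part i)" using five[OF i] by (elim disjE) (simp_all add: part c)
      fix j :: nat assume j: "j < 5" "i \<noteq> j"
      show "touch (part i) (part j) \<longleftrightarrow> (i, j) \<in> parcs gem"
        using five[OF i] five[OF j(1)] j(2)
        by (elim disjE) (simp_all add: part gem_arc_iff tv)
    qed
    then show False using gem_model_induced_minor[OF sg _ reduces_to.refl] nm by blast
  qed
qed

section \<open>Components as library digraphs\<close>

lemma pair_graph_induce:
  assumes "pair_graph G" "S \<subseteq> pverts G"
  shows "pair_graph \<lparr>pverts = S, parcs = parcs G \<inter> S \<times> S\<rparr>"
    "with_proj G \<restriction> S = with_proj \<lparr>pverts = S, parcs = parcs G \<inter> S \<times> S\<rparr>"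
proof -
  interpret sgraph "pverts G" "parcs G" using pair_graph_sgraph assms by blast
  show "pair_graph \<lparr>pverts = S, parcs = parcs G \<inter> S \<times> S\<rparr>"
    using finite_V assms(2) sym_E irrefl_E finite_subset
    by (intro sgraph_pair_graph, unfold_locales) (auto simp: sym_def)
  show "with_proj G \<restriction> S = with_proj \<lparr>pverts = S, parcs = parcs G \<inter> S \<times> S\<rparr>"
    by (auto simp: induce_subgraph_def with_proj_def)
qed

lemma graph_induce:
  assumes "pair_graph G" "S \<subseteq> pverts G"
  shows "graph (with_proj G \<restriction> S)"
  using pair_graph.pair_graphD_graph pair_graph_induce assms by metis

lemma subgraph_induce_mono:
  assumes "pair_graph G" "S \<subseteq> T" "T \<subseteq> pverts G"
  shows "subgraph (with_proj G \<restriction> S) (with_proj G \<restriction> T)"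
proof -
  have "wf_digraph (with_proj G \<restriction> S)" "wf_digraph (with_proj G \<restriction> T)"
    using graph_induce assms by (meson graph_def digraph_def fin_digraph_def order_trans)+
  then show ?thesis using assms(2) by (intro subgraphI) (auto simp: compatible_def)
qed

text \<open>A reachability chain cannot leave a set that has no edge to the rest of
  \<open>verts C\<close>.\<close>

lemma connected_imp_conn:
  assumes pg: "pair_graph G" and sub: "subgraph C (with_proj G)" and con: "connected C"
  shows "sgraph.conn (pverts G) (parcs G) (verts C)"
proof -
  interpret sgraph "pverts G" "parcs G" using pair_graph_sgraph pg by blast
  let ?R = "parcs (mk_symmetric C)"
  have ne: "verts C \<noteq> {}"
    and reach: "\<And>u v. u \<in> verts C \<Longrightarrow> v \<in> verts C \<Longrightarrow> (u, v) \<in> rtrancl_on (verts C) ?R"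
    using con by (auto simp: connected_def strongly_connected_def reachable_def)
  have R: "?R \<subseteq> parcs G"
    using sub sym_E by (auto simp: parcs_mk_symmetric subgraph_def compatible_def sym_def)
  show ?thesis
    unfolding conn_def
  proof (intro conjI allI impI)
    show "verts C \<noteq> {}" by (rule ne)
    show "verts C \<subseteq> pverts G" using sub by (auto simp: subgraph_def)
    fix A assume A: "A \<noteq> {}" "A \<subset> verts C"
    then obtain a b where ab: "a \<in> A" "b \<in> verts C" "b \<notin> A" by blast
    show "touch A (verts C - A)"
    proof (rule ccontr)
      assume nt: "\<not> ?thesis"
      have "(a, b) \<in> rtrancl_on (verts C) ?R" using reach ab A by blast
      then have "b \<in> A"
      proof (induction rule: rtrancl_on_induct)
        case (step y z)
        then show ?case using nt R unfolding touch_iff adj_def by blast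
      qed (use ab in simp)
      then show False using ab by blast
    qed
  qed
qed

lemma conn_imp_connected:
  assumes pg: "pair_graph G" and con: "sgraph.conn (pverts G) (parcs G) S"
  shows "connected (with_proj G \<restriction> S)"
proof -
  interpret sgraph "pverts G" "parcs G" using pair_graph_sgraph pg by blast
  let ?R = "parcs (mk_symmetric (with_proj G \<restriction> S))"
  have R: "(x, y) \<in> ?R" if "(x, y) \<in> parcs G" "x \<in> S" "y \<in> S" for x y
    using that by (force simp: parcs_mk_symmetric)
  have "(u, v) \<in> rtrancl_on S ?R" if uv: "u \<in> S" "v \<in> S" for u v
  proof -
    let ?A = "{v \<in> S. (u, v) \<in> rtrancl_on S ?R}"
    have "?A = S"
    proof (rule ccontr)
      assume "?A \<noteq> S"
      then have "touch ?A (S - ?A)" using conn_touch[OF con, of ?A] uv by auto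
      then obtain x y where "x \<in> ?A" "y \<in> S - ?A" "(x, y) \<in> parcs G"
        unfolding touch_iff adj_def by blast
      then show False using R rtrancl_on_into_rtrancl_on by fast
    qed
    then show ?thesis using uv by blast
  qed
  then show ?thesis
    using connD(1)[OF con] by (auto simp: connected_def strongly_connected_def reachable_def)
qed

text \<open>Maximality is tested against two induced subgraphs: the one on \<open>verts C\<close>
  shows that \<open>C\<close> is induced, and the one with an added neighbour shows that no
  neighbour in \<open>W\<close> is left out.\<close>

lemma max_connected_comp:
  assumes pg: "pair_graph G" and W: "W \<subseteq> pverts G"
    and C: "pre_digraph.max_subgraph (with_proj G \<restriction> W) connected C"
  shows "C = with_proj G \<restriction> verts C" "sgraph.is_comp (pverts G) (parcs G) W (verts C)"
proof -
  interpret sgraph "pverts G" "parcs G" using pair_graph_sgraph pg by blast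
  let ?G = "with_proj G" and ?D = "verts C"
  have sub: "subgraph C (?G \<restriction> W)" and con: "connected C"
    and max: "\<And>H. H \<noteq> C \<Longrightarrow> subgraph C H \<Longrightarrow> subgraph H (?G \<restriction> W) \<Longrightarrow> \<not> connected H"
    using C by (auto simp: pre_digraph.max_subgraph_def)
  have DW: "?D \<subseteq> W" using sub by (auto simp: subgraph_def)
  have GG: "?G \<restriction> pverts G = ?G"
    using E_sub by (auto simp: induce_subgraph_def with_proj_def)
  have subG: "subgraph C ?G"
    using subgraph_trans[OF sub] subgraph_induce_mono[OF pg W order_refl] GG by simp
  have c: "conn ?D" by (rule connected_imp_conn[OF pg subG con])
  have subD: "subgraph C (?G \<restriction> ?D)" by (rule subgraph_induce_subgraphI2[OF subG])
  have eq: "?G \<restriction> T = C" if "?D \<subseteq> T" "T \<subseteq> W" "conn T" for T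
  proof (rule ccontr)
    assume ne: "?G \<restriction> T \<noteq> C"
    have "subgraph C (?G \<restriction> T)"
      using subgraph_trans[OF subD subgraph_induce_mono[OF pg that(1)]] that W by blast
    then show False
      using max[OF ne _ subgraph_induce_mono[OF pg that(2) W]] conn_imp_connected[OF pg that(3)] by blast
  qed
  show "C = ?G \<restriction> ?D" using eq[of ?D] DW c by simp
  have "\<not> touch ?D (W - ?D)"
  proof
    assume "touch ?D (W - ?D)"
    then obtain y where y: "y \<in> W - ?D" "nbr y ?D"
      using touch_commute[of ?D] unfolding touch_def by blast
    have "?G \<restriction> insert y ?D = C" using eq[of "insert y ?D"] y DW conn_insert[OF c y(2)] by auto
    then have "verts C = insert y ?D" by (metis induce_subgraph_verts)
    then show False using y by blast
  qed
  then show "is_comp W ?D" using DW c by (simp add: is_comp_def)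
qed

lemma p4free_cograph:
  assumes pg: "pair_graph G" and S: "S \<subseteq> pverts G"
    and p4: "sgraph.p4free (parcs G) S"
  shows "cograph (with_proj G \<restriction> S)"
proof -
  interpret sgraph "pverts G" "parcs G" using pair_graph_sgraph pg by blast
  let ?C = "with_proj G \<restriction> S"
  have False if H: "induced_subgraph H ?C" and iso: "digraph_iso (with_proj path4) H" for H
  proof -
    obtain f where f: "pre_digraph.digraph_isomorphism (with_proj path4) f"
      "H = app_iso f (with_proj path4)" using iso by (auto simp: digraph_iso_def)
    let ?g = "iso_verts f"
    have proj: "tail H = fst" "head H = snd"
      using H by (auto simp: induced_subgraph_def subgraph_def compatible_def)
    have arcs_H: "arcs H = {e \<in> parcs G. fst e \<in> verts H \<and> snd e \<in> verts H}"
      and vS: "verts H \<subseteq> S"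
      using H by (auto simp: induced_subgraph_def subgraph_def)
    have vH: "?g i \<in> verts H" if "i < 4" for i using that f(2) by (auto simp: path4_def)
    have inj: "inj_on ?g {..<4}"
      using f(1) by (simp add: pre_digraph.digraph_isomorphism_def path4_def)
    \<comment> \<open>The isomorphism carries its own arc map. Since tail and head in
      \<open>H\<close> are the projections, that map is forced to act as \<open>?g\<close> on both
      coordinates.\<close>
    have arc: "iso_arcs f a = (?g (fst a), ?g (snd a))" if "a \<in> parcs path4" for a
    proof -
      have "?g (fst a) = iso_tail f (iso_arcs f a)" "?g (snd a) = iso_head f (iso_arcs f a)"
        using f(1) that by (auto simp: pre_digraph.digraph_isomorphism_def)
      moreover have "iso_tail f = fst" "iso_head f = snd" using proj f(2) by simp_all
      ultimately show ?thesis by simp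
    qed
    have adj_iff: "adj (?g i) (?g j) \<longleftrightarrow> (i, j) \<in> parcs path4" if ij: "i < 4" "j < 4" for i j
    proof
      assume "adj (?g i) (?g j)"
      then have "(?g i, ?g j) \<in> arcs H" using vH ij arcs_H by (auto simp: adj_def)
      then obtain a where a: "a \<in> parcs path4" "(?g i, ?g j) = iso_arcs f a" using f(2) by auto
      then have "?g i = ?g (fst a)" "?g j = ?g (snd a)" using arc by auto
      moreover have "fst a < 4" "snd a < 4" using a(1) by (auto simp: path4_def)
      ultimately have "i = fst a" "j = snd a" using inj ij by (auto dest: inj_onD)
      then show "(i, j) \<in> parcs path4" using a(1) by simp
    next
      assume a: "(i, j) \<in> parcs path4"
      then have "iso_arcs f (i, j) \<in> arcs H" using f(2) by auto
      then show "adj (?g i) (?g j)" using arc[OF a] arcs_H by (simp add: adj_def)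
    qed
    have "P4 (?g 0) (?g 1) (?g 2) (?g 3)" unfolding P4_def by (simp add: adj_iff path4_def)
    moreover have "?g 0 \<in> S" "?g 1 \<in> S" "?g 2 \<in> S" "?g 3 \<in> S" using vH vS by auto
    ultimately show False using p4 unfolding p4free_def by blast
  qed
  then show ?thesis using graph_induce[OF pg S] by (auto simp: cograph_def)
qed

text \<open>\<open>zip xs (tl xs)\<close> is the arc list of the walk through \<open>xs\<close>; for
  a single vertex it is \<open>[]\<close>, as \<open>is_path_along\<close> expects.\<close>

lemma pawalk_verts_zip: "xs \<noteq> [] \<Longrightarrow> pawalk_verts (hd xs) (zip xs (tl xs)) = xs"
proof (induction xs)
  case (Cons x xs)
  then show ?case by (cases xs) auto
qed simp

lemma pcas_zip: "xs \<noteq> [] \<Longrightarrow> pcas (hd xs) (zip xs (tl xs)) (last xs)"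
proof (induction xs)
  case (Cons x xs)
  then show ?case by (cases xs) auto
qed simp

lemma map_fst_zip_tl: "map fst (zip xs (tl xs)) = butlast xs"
proof (induction xs)
  case (Cons x xs)
  then show ?case by (cases xs) auto
qed simp

lemma (in sgraph) ipath_arcs:
  "ipath xs \<Longrightarrow> E \<inter> set xs \<times> set xs = set (zip xs (tl xs)) \<union> (set (zip xs (tl xs)))\<inverse>"
proof (induction xs)
  case (Cons x xs)
  show ?case
  proof (cases xs)
    case Nil
    then show ?thesis using irrefl_E by auto
  next
    case (Cons y ys)
    have x: "x \<notin> set xs" "\<And>z. z \<in> set xs \<Longrightarrow> (x, z) \<in> E \<longleftrightarrow> z = y" "\<And>z. z \<in> set xs \<Longrightarrow> (z, x) \<in> E \<longleftrightarrow> z = y"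
      using Cons.prems Cons adj_commute by (auto simp: adj_def)
    have "E \<inter> set (x # xs) \<times> set (x # xs) = (E \<inter> set xs \<times> set xs) \<union> {(x, y), (y, x)}"
      using x irrefl_E Cons by auto
    also have "E \<inter> set xs \<times> set xs = set (zip xs (tl xs)) \<union> (set (zip xs (tl xs)))\<inverse>"
      using Cons.IH Cons.prems by simp
    finally show ?thesis using Cons by auto
  qed
qed simp

lemma ipath_is_path_along:
  assumes pg: "pair_graph G" and xs: "sgraph.ipath (pverts G) (parcs G) xs" "xs \<noteq> []"
  shows "is_path_along (with_proj G \<restriction> set xs) (hd xs) (zip xs (tl xs)) (last xs)"
proof -
  interpret sgraph "pverts G" "parcs G" using pair_graph_sgraph pg by blast
  define K where "K = \<lparr>pverts = set xs, parcs = parcs G \<inter> set xs \<times> set xs\<rparr>"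
  have K: "with_proj G \<restriction> set xs = with_proj K"
    unfolding K_def by (rule pair_graph_induce(2)[OF pg ipath_V[OF xs(1)]])
  have arcs: "parcs K = set (zip xs (tl xs)) \<union> (set (zip xs (tl xs)))\<inverse>"
    unfolding K_def by (simp add: ipath_arcs[OF xs(1)])
  have ends: "arc_to_ends (with_proj K) = id" by (auto simp: arc_to_ends_def)
  have "pre_digraph.apath (with_proj K) (hd xs) (zip xs (tl xs)) (last xs)"
    using xs(2) arcs ipath_distinct[OF xs(1)] pcas_zip[OF xs(2)] pawalk_verts_zip[OF xs(2)]
    by (auto simp: pre_digraph.apath_def pre_digraph.awalk_def cas_with_proj_eq
      awalk_verts_with_proj_eq K_def)
  then show ?thesis
    using arcs pawalk_verts_zip[OF xs(2)]
    by (simp add: is_path_along_def K ends awalk_verts_with_proj_eq) (simp add: K_def)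
qed

theorem mainTheorem3:
  fixes G :: "'a pair_pre_digraph"
  assumes "pair_graph G"
    and "k_connected 2 (with_proj G)"
    and "\<not> induced_minor gem G"
  shows "\<exists>X \<subseteq> pverts G. card X \<le> 6 \<and>
    (\<forall>C. pre_digraph.max_subgraph (with_proj G \<restriction> (pverts G - X)) connected C \<longrightarrow>
      cograph C \<or>
      (\<exists>u p v. is_path_along C u p v \<and>
        (\<forall>w \<in> set (pre_digraph.inner_verts C p). in_degree (with_proj G) w = 2)))"
proof -
  interpret sgraph "pverts G" "parcs G" using pair_graph_sgraph assms(1) by blast
  have gf: gemfree by (rule not_induced_minor_gemfree[OF assms(1,3)])
  have conn_del: "conn (pverts G - S)" if S: "S \<subseteq> pverts G" "card S < 2" for S
  proof -
    have "with_proj G \<restriction> pverts G = with_proj G"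
      using E_sub by (auto simp: induce_subgraph_def with_proj_def)
    then have "subgraph (with_proj G \<restriction> (pverts G - S)) (with_proj G)"
      using subgraph_induce_mono[OF assms(1), of "pverts G - S" "pverts G"] by simp
    moreover have "connected (with_proj G \<restriction> (pverts G - S))"
      using assms(2) S by (simp add: k_connected_def)
    ultimately show ?thesis using connected_imp_conn[OF assms(1)] by (metis induce_subgraph_verts)
  qed
  \<comment> \<open>The sets with fewer than two vertices are the empty set and the singletons,
    which is what \<open>two_connected\<close> asks for.\<close>
  have tc: two_connected
    using conn_del[of "{}"] conn_del[of "{v}" for v] assms(2)
    by (auto simp: two_connected_def k_connected_def)
  obtain X where X: "X \<subseteq> pverts G" "card X \<le> 6" "\<And>D. is_comp (pverts G - X) D \<Longrightarrow> good D"
    using gemfree_decomposition[OF gf tc] by blast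
  have "cograph C \<or> (\<exists>u p v. is_path_along C u p v \<and>
      (\<forall>w \<in> set (pre_digraph.inner_verts C p). in_degree (with_proj G) w = 2))"
    if C: "pre_digraph.max_subgraph (with_proj G \<restriction> (pverts G - X)) connected C" for C
  proof -
    note D = max_connected_comp[OF assms(1) _ C, OF Diff_subset]
    have DV: "verts C \<subseteq> pverts G" using is_compD(5)[OF D(2)] .
    from X(3)[OF D(2)] show ?thesis
      unfolding good_def
    proof
      assume "p4free (verts C)"
      then show ?thesis using p4free_cograph[OF assms(1) DV] D(1) by simp
    next
      assume "\<exists>xs. ipath xs \<and> xs \<noteq> [] \<and> set xs = verts C \<and> (\<forall>x\<in>set (butlast (tl xs)). card {y. adj x y} = 2)"
      then obtain xs where xs: "ipath xs" "xs \<noteq> []" "set xs = verts C"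
        "\<And>x. x\<in>set (butlast (tl xs)) \<Longrightarrow> card {y. adj x y} = 2" by blast
      have path: "is_path_along C (hd xs) (zip xs (tl xs)) (last xs)"
        using ipath_is_path_along[OF assms(1) xs(1,2)] D(1) xs(3) by simp
      have "tail C = fst" by (subst D(1)) simp
      \<comment> \<open>The inner vertices of a walk are the tails of its arcs without the first;
        here this is \<open>tl (butlast xs)\<close>, which equals the list used in
        \<open>good\<close>.\<close>
      then have inner: "pre_digraph.inner_verts C (zip xs (tl xs)) = butlast (tl xs)"
        by (simp add: pre_digraph.inner_verts_def map_fst_zip_tl butlast_tl)
      have deg: "in_degree (with_proj G) w = card {y. adj w y}" for w
      proof -
        have "in_arcs (with_proj G) w = (\<lambda>y. (y, w)) ` {y. adj w y}"
          using adj_commute by (auto simp: in_arcs_def adj_def)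
        then show ?thesis by (simp add: in_degree_def card_image inj_on_def)
      qed
      show ?thesis using path xs(4) unfolding deg inner[symmetric] by blast
    qed
  qed
  then show ?thesis using X(1,2) by blast
qed

end
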